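(* Let $g\ge 4$ be an even integer. Let $G=(L\sqcup R,E)$ be a bipartite graph of girth at least $g$, with vertex set $V=L\sqcup R$ and $|L|=|R|=n$. Let $\mu$ be a probability distribution on the perfect matchings of $G$, and let $p_e:=\mathbb{P}_{M\sim\mu}(e\in M)$ for $e\in E$ and $\mathbf p:=(p_e)_{e\in E}$. Then $$H(\mu)\le \Phi_G(\mathbf p).$$ Equivalently, $$H(\mu)-H_{\mathrm B}(\mathbf p)\le \frac{2}{g}\sum_{v\in V}F(\mathbf p_v).$$
   Context: All logarithms are natural and $0\log 0=0$. Graphs are finite and simple; girth is the length of a shortest cycle (infinite for forests). Let $\Delta_d=\{\mathbf q\in\mathbb{R}_{\ge0}^d:\sum_i q_i=1\}$. For $\mathbf q\in\Delta_d$ define $H(\mathbf q)=-\sum_{i=1}^d q_i\log q_i$, $H_{\mathrm c}(\mathbf q)=-\sum_{i=1}^d(1-q_i)\log(1-q_i)$, and $S(\mathbf q)=H(\mathbf q)-H_{\mathrm c}(\mathbf q)$. For a probability distribution $\mu$ on a finite set, $H(\mu)$ is the Shannon entropy of its probability vector. For $\pi\in\operatorname{Sym}(d)$ and $t\in[d]$ let $s_t^\pi(\mathbf q)=\sum_{r=t}^d q_{\pi(r)}$, and define $$F(\mathbf q)=\mathbb{E}_\pi\Big[\sum_{t=1}^d q_{\pi(t)}\log s_t^\pi(\mathbf q)\Big]+H_{\mathrm c}(\mathbf q),$$ with $\pi$ uniformly distributed on $\operatorname{Sym}(d)$ (terms with $q_{\pi(t)}=0$ are zero). These functionals are symmetric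 in the coordinates, so they may be applied to probability vectors indexed by any finite set. For a bipartite graph $G=(V,E)$, $\operatorname{PM}(G)=\{\mathbf p\in\mathbb{R}_{\ge0}^E:\sum_{e\ni v}p_e=1\ \forall v\in V\}$. For $\mathbf p\in\operatorname{PM}(G)$ write $\mathbf p_v=(p_e)_{e\ni v}$, a probability vector indexed by the edges incident to $v$. The Bethe entropy is $$H_{\mathrm B}(\mathbf p)=\sum_{e\in E}\big(-p_e\log p_e+(1-p_e)\log(1-p_e)\big)=\frac12\sum_{v\in V}S(\mathbf p_v),$$ and $$\Phi_G(\mathbf p)=H_{\mathrm B}(\mathbf p)+\frac2g\sum_{v\in V}F(\mathbf p_v).$$ *)

theory Defs
  imports
    "HOL-Probability.Probability"
    "HOL-Combinatorics.Combinatorics"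
    "HOL-Library.Extended_Nat"
begin

section \<open>Bipartite graphs, girth and perfect matchings\<close>

text \<open>
  A graph is given by its set of edges, an edge being the two-element set of its endpoints.
  Disjointness of \<open>L\<close> and \<open>R\<close> makes every edge below a genuine two-element set.
\<close>

definition bipartite_graph :: "'a set \<Rightarrow> 'a set \<Rightarrow> 'a set set \<Rightarrow> bool" where
  "bipartite_graph L R E \<longleftrightarrow>
     finite L \<and> finite R \<and> L \<inter> R = {} \<and> (\<forall>e\<in>E. \<exists>u\<in>L. \<exists>v\<in>R. e = {u, v})"

text \<open>
  A cycle is the list of its distinct vertices in cyclic order, without repeating the first one,
  so that its length is the length of the list.
\<close>

definition is_cycle :: "'a set set \<Rightarrow> 'a list \<Rightarrow> bool" where
  "is_cycle E xs \<longleftrightarrow> 3 \<le> length xs \<and> distinct xs \<and>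
     (\<forall>i<length xs. {xs ! i, xs ! (Suc i mod length xs)} \<in> E)"

text \<open>The infimum of the empty set is \<open>\<infinity>\<close>, which is the girth of a forest.\<close>

definition girth :: "'a set set \<Rightarrow> enat" where
  "girth E = (INF xs\<in>{xs. is_cycle E xs}. enat (length xs))"

definition incident :: "'a set set \<Rightarrow> 'a \<Rightarrow> 'a set set" where
  "incident E v = {e\<in>E. v \<in> e}"

definition perfect_matchings :: "'a set \<Rightarrow> 'a set set \<Rightarrow> 'a set set set" where
  "perfect_matchings V E = {M. M \<subseteq> E \<and> (\<forall>v\<in>V. \<exists>!e. e \<in> M \<and> v \<in> e)}"


section \<open>Entropy functionals\<close>

text \<open>
  A vector indexed by a finite set \<open>I\<close> is a function restricted to \<open>I\<close>; in particular
  \<open>\<^bold>p\<^sub>v\<close> is \<open>\<^bold>p\<close> on the index set \<open>incident E v\<close>. Since \<^prop>\<open>ln 0 = (0::real)\<close>, the convention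
  \<open>0 log 0 = 0\<close> holds automatically.
\<close>

definition shannon_entropy :: "'i set \<Rightarrow> ('i \<Rightarrow> real) \<Rightarrow> real" where
  "shannon_entropy I q = - (\<Sum>i\<in>I. q i * ln (q i))"

definition complementary_entropy :: "'i set \<Rightarrow> ('i \<Rightarrow> real) \<Rightarrow> real" where
  "complementary_entropy I q = - (\<Sum>i\<in>I. (1 - q i) * ln (1 - q i))"

text \<open>
  A uniform \<open>\<pi> \<in> Sym(d)\<close> is a uniform ordering of the coordinates. For an arbitrary finite index
  set the orderings are the duplicate-free enumerations of it as a list (with positions counted
  from 0). Lemma \<open>F_Sym\<close> recovers the formula over \<open>Sym(d)\<close> for every numbering of the index set.
\<close>

definition F :: "'i set \<Rightarrow> ('i \<Rightarrow> real) \<Rightarrow> real" where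
  "F I q =
     measure_pmf.expectation (pmf_of_set (permutations_of_set I))
       (\<lambda>xs. \<Sum>t<card I. q (xs ! t) * ln (\<Sum>r=t..<card I. q (xs ! r)))
     + complementary_entropy I q"

lemma F_Sym:
  fixes q :: "'i \<Rightarrow> real" and \<sigma> :: "nat \<Rightarrow> 'i"
  assumes \<sigma>: "bij_betw \<sigma> {1..d} I"
  shows "F I q =
    measure_pmf.expectation (pmf_of_set {\<pi>. \<pi> permutes {1..d}})
      (\<lambda>\<pi>. \<Sum>t=1..d. q (\<sigma> (\<pi> t)) * ln (\<Sum>r=t..d. q (\<sigma> (\<pi> r))))
    - (\<Sum>i=1..d. (1 - q (\<sigma> i)) * ln (1 - q (\<sigma> i)))"
proof -
  let ?P = "{\<pi>. \<pi> permutes {1..d}}"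
  define h where "h = (\<lambda>\<pi>. map (\<lambda>i. \<sigma> (\<pi> (Suc i))) [0..<d])"
  have fin: "finite I" and card: "card I = d"
    using \<sigma> bij_betw_finite bij_betw_same_card by fastforce+
  have finP: "finite ?P" and cardP: "card ?P = fact d"
    by (simp_all add: finite_permutations card_permutations)
  have neP: "?P \<noteq> {}"
    using permutes_id by blast
  have h_in: "h \<pi> \<in> permutations_of_set I" if "\<pi> permutes {1..d}" for \<pi>
  proof -
    have b: "bij_betw (\<lambda>i. \<sigma> (\<pi> i)) {1..d} I"
      using bij_betw_trans[OF permutes_imp_bij[OF that] \<sigma>] by (simp add: o_def)
    have "bij_betw Suc {0..<d} {1..d}"
      by (intro bij_betwI[where g = "\<lambda>i. i - 1"]) auto
    from bij_betw_trans[OF this b] have "bij_betw (\<lambda>i. \<sigma> (\<pi> (Suc i))) {0..<d} I"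
      by (simp add: o_def)
    thus ?thesis
      by (auto simp: h_def permutations_of_set_def distinct_map bij_betw_def)
  qed
  have "inj_on h ?P"
  proof (rule inj_onI)
    fix \<pi> \<pi>' assume asm: "\<pi> \<in> ?P" "\<pi>' \<in> ?P" "h \<pi> = h \<pi>'"
    have "\<pi> i = \<pi>' i" for i
    proof (cases "i \<in> {1..d}")
      case True
      then obtain j where j: "i = Suc j" "j < d" by (cases i) auto
      from asm(3) have "h \<pi> ! j = h \<pi>' ! j" by simp
      with j have "\<sigma> (\<pi> i) = \<sigma> (\<pi>' i)" by (simp add: h_def)
      moreover have "\<pi> i \<in> {1..d}" "\<pi>' i \<in> {1..d}"
        using asm True by (auto simp: permutes_in_image simp del: atLeastAtMost_iff)
      ultimately show ?thesis using \<sigma> by (auto simp: bij_betw_def dest: inj_onD)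
    next
      case False
      with asm show ?thesis by (auto simp: permutes_def)
    qed
    thus "\<pi> = \<pi>'" by auto
  qed
  moreover from this have "h ` ?P = permutations_of_set I"
    using h_in fin card cardP by (intro card_subset_eq) (auto simp: card_image)
  ultimately have h: "bij_betw h ?P (permutations_of_set I)"
    by (simp add: bij_betw_def)
  have inner: "(\<Sum>t<card I. q (h \<pi> ! t) * ln (\<Sum>r=t..<card I. q (h \<pi> ! r)))
      = (\<Sum>t=1..d. q (\<sigma> (\<pi> t)) * ln (\<Sum>r=t..d. q (\<sigma> (\<pi> r))))" for \<pi>
  proof -
    have "(\<Sum>r=t..<d. q (h \<pi> ! r)) = (\<Sum>r=Suc t..d. q (\<sigma> (\<pi> r)))" for t
      by (rule sum.reindex_bij_witness[of _ "\<lambda>r. r - 1" Suc]) (auto simp: h_def)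
    thus ?thesis unfolding card
      by (intro sum.reindex_bij_witness[of _ "\<lambda>r. r - 1" Suc]) (auto simp: h_def)
  qed
  have "measure_pmf.expectation (pmf_of_set (permutations_of_set I))
       (\<lambda>xs. \<Sum>t<card I. q (xs ! t) * ln (\<Sum>r=t..<card I. q (xs ! r))) =
    measure_pmf.expectation (pmf_of_set ?P)
       (\<lambda>\<pi>. \<Sum>t<card I. q (h \<pi> ! t) * ln (\<Sum>r=t..<card I. q (h \<pi> ! r)))"
    unfolding map_pmf_of_set_bij_betw[OF h neP finP, symmetric] integral_map_pmf ..
  moreover have "(\<Sum>i\<in>I. (1 - q i) * ln (1 - q i)) = (\<Sum>i=1..d. (1 - q (\<sigma> i)) * ln (1 - q (\<sigma> i)))"
    using sum.reindex_bij_betw[OF \<sigma>, of "\<lambda>i. (1 - q i) * ln (1 - q i)"] by simp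
  ultimately show ?thesis
    unfolding F_def complementary_entropy_def inner by simp
qed

definition bethe_entropy :: "'a set set \<Rightarrow> ('a set \<Rightarrow> real) \<Rightarrow> real" where
  "bethe_entropy E p = (\<Sum>e\<in>E. - p e * ln (p e) + (1 - p e) * ln (1 - p e))"

definition Phi :: "nat \<Rightarrow> 'a set \<Rightarrow> 'a set set \<Rightarrow> ('a set \<Rightarrow> real) \<Rightarrow> real" where
  "Phi g V E p = bethe_entropy E p + 2 / real g * (\<Sum>v\<in>V. F (incident E v) p)"

end

theory Submission
  imports Defs
begin

text \<open>
  Write \<open>g = 2k\<close>, let \<open>S\<close> be the entropy minus the complementary entropy of a probability vector
  and \<open>R = S + F\<close>. Every edge has two endpoints, so \<open>Phi\<close> is the sum over the vertices \<open>u\<close> of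
  \<open>(1/2 - 1/k) S(p\<^sub>u) + (1/k) R(p\<^sub>u)\<close>. Revealing the matching edge at a uniformly random left vertex
  expresses \<open>n H(\<mu>)\<close> as the sum over the edges \<open>m\<close> of \<open>p\<^sub>m (ln (1/p\<^sub>m) + H(\<mu> | m))\<close>. By induction
  on the support of \<open>\<mu>\<close> it is therefore enough that the same revelation decreases \<open>Phi\<close> by at least
  as much as it decreases the entropy (\<open>potential_drop\<close>). Since \<open>p\<close> is a mixture of the conditional
  marginals \<open>p\<^sup>m\<close>, the decrease of \<open>Phi\<close> is an average over \<open>m\<close> of divergences \<open>d\<^sub>S\<close> and \<open>d\<^sub>R\<close> of
  \<open>p\<^sup>m\<^sub>u\<close> from \<open>p\<^sub>u\<close>, the Bregman divergences of \<open>-S\<close> and \<open>-R\<close>. The lower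
  bound for it has a local, a far and a near part.

  Two inequalities hold at each vertex: \<open>0 \<le> d\<^sub>S\<close>, and the relative entropy is at most \<open>2 d\<^sub>R\<close>.
  Both follow from a Hlawka inequality for \<open>a ln (a/b)\<close> (\<open>info_hlawka\<close>).

  Far from a fixed edge \<open>m\<close>, put \<open>2 ln (1/p\<^sub>m)\<close>, which is twice the binary divergence of \<open>m\<close>, on \<open>m\<close> and
  push it outwards. The divergence \<open>d\<^sub>S\<close> at \<open>u\<close> is twice the relative entropy at \<open>u\<close> minus the binary
  divergences of the edges at \<open>u\<close>, and the relative entropy is at least the binary divergence of
  any one of them; hence the binary divergence of the edge leading to \<open>u\<close> is at most \<open>d\<^sub>S\<close> at
  \<open>u\<close> plus the binary divergences of the other edges at \<open>u\<close>. The girth makes the neighbourhood of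
  \<open>m\<close> a tree, so whatever is not absorbed by \<open>d\<^sub>S\<close> before level \<open>\<rho>\<close> arrives at the distinct vertices of level
  \<open>\<rho>\<close>, where \<open>2 d\<^sub>R\<close> pays for it. Each of the \<open>k - 2\<close> levels \<open>\<rho> = 2, ..., k - 1\<close> thus shows that half of
  the total of \<open>d\<^sub>S\<close> plus the total of \<open>d\<^sub>R\<close> over that level is at least \<open>ln (1/p\<^sub>m)\<close> (\<open>far_bound\<close>).

  Near \<open>m\<close>, that is on levels 0 and 1, the divergences \<open>d\<^sub>R\<close>, averaged over \<open>m\<close>, contribute
  at least the sum of all vertex entropies, which is \<open>2 \<Sum>\<^sub>m p\<^sub>m ln (1/p\<^sub>m)\<close> (\<open>near_bound\<close>). The uniformly
  random order in \<open>F\<close> is what makes this work: erasing each coordinate in turn telescopes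
  (\<open>suffix_mean_removal\<close>). Together the two parts give \<open>k \<Sum>\<^sub>m p\<^sub>m ln (1/p\<^sub>m)\<close>, as needed.
\<close>

section \<open>A Hlawka inequality for relative entropy\<close>

text \<open>
  The contribution of one outcome to a relative entropy. It is the perspective of \<open>xlnx\<close>, hence
  convex and homogeneous of degree one in the pair \<open>(a, b)\<close>.
\<close>

definition info :: "real \<Rightarrow> real \<Rightarrow> real" where
  "info a b = a * ln (a / b)"

definition xlnx :: "real \<Rightarrow> real" where
  "xlnx x = x * ln x"

lemma info_0_left [simp]: "info 0 b = 0"
  by (simp add: info_def)

lemma info_1_1 [simp]: "info 1 1 = 0"
  by (simp add: info_def)

lemma info_eq_xlnx:
  assumes "0 \<le> a" "0 \<le> b" "b = 0 \<Longrightarrow> a = 0"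
  shows "info a b = xlnx a - a * ln b"
  using assms by (cases "a = 0") (auto simp: info_def xlnx_def ln_div algebra_simps)

lemma info_scale: "0 \<le> c \<Longrightarrow> info (c * a) (c * b) = c * info a b"
  by (cases "c = 0") (auto simp: info_def)

text \<open>
  The supporting hyperplane at the ratio \<open>t\<close>, with equality at \<open>t = a / b\<close>; it yields the log sum
  inequality below without differentiating.
\<close>

lemma info_ge_tangent:
  assumes "0 \<le> a" "0 \<le> b" "b = 0 \<Longrightarrow> a = 0" "0 < t"
  shows "a * ln t + a - b * t \<le> info a b"
proof (cases "a = 0")
  case False
  with assms have ab: "0 < a" "0 < b" by force+
  have "ln (b * t / a) \<le> b * t / a - 1"
    using ab \<open>0 < t\<close> by (intro ln_le_minus_one) auto
  hence "a * ln (b * t / a) \<le> b * t - a"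
    using ab by (simp add: field_simps)
  moreover have "ln (b * t / a) = ln t - ln (a / b)"
    using ab \<open>0 < t\<close> by (simp add: ln_div ln_mult)
  ultimately show ?thesis
    by (simp add: info_def algebra_simps)
qed (use assms in auto)

lemma info_add_le:
  assumes "0 \<le> a" "0 \<le> b" "b = 0 \<Longrightarrow> a = 0"
    and "0 \<le> a'" "0 \<le> b'" "b' = 0 \<Longrightarrow> a' = 0"
  shows "info (a + a') (b + b') \<le> info a b + info a' b'"
proof (cases "a + a' = 0")
  case True
  hence "a = 0" "a' = 0" using assms by auto
  thus ?thesis by simp
next
  case False
  hence pos: "0 < a + a'" "0 < b + b'" using assms by (force simp: less_le add_nonneg_eq_0_iff)+
  let ?t = "(a + a') / (b + b')"
  have "a * ln ?t + a - b * ?t + (a' * ln ?t + a' - b' * ?t) \<le> info a b + info a' b'"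
    using assms pos by (intro add_mono info_ge_tangent) auto
  moreover have "b * ?t + b' * ?t = a + a'"
    using pos by (simp only: distrib_right[symmetric]) simp
  ultimately show ?thesis
    by (simp add: info_def algebra_simps)
qed

lemma info_convex_comb_le:
  assumes "0 \<le> a" "0 \<le> b" "b = 0 \<Longrightarrow> a = 0"
    and "0 \<le> a'" "0 \<le> b'" "b' = 0 \<Longrightarrow> a' = 0"
    and "0 \<le> s" "0 \<le> t"
  shows "info (s * a + t * a') (s * b + t * b') \<le> s * info a b + t * info a' b'"
  using info_add_le[of "s * a" "s * b" "t * a'" "t * b'"] assms
  by (auto simp: info_scale)

text \<open>
  Let two of the three ratios \<open>a'/a\<close>, \<open>b'/b\<close>, \<open>c'/c\<close> lie on the same side of the overall ratio \<open>N'/N\<close>.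
  Then the vectors \<open>(b'+c', b+c)\<close> and \<open>(c'+a', c+a)\<close> both lie in the cone spanned by
  \<open>(N', N)\<close> and \<open>(c', c)\<close>, and they have the same sum as these two, so convexity and homogeneity
  bound their values by those of the generators. The remaining pair is handled by subadditivity.
\<close>

lemma info_hlawka_aux:
  fixes a b c a' b' c' :: real
  defines "N \<equiv> a + b + c" and "N' \<equiv> a' + b' + c'"
  assumes nonneg: "0 \<le> a" "0 \<le> b" "0 \<le> c" "0 \<le> a'" "0 \<le> b'" "0 \<le> c'"
    and ac: "a = 0 \<Longrightarrow> a' = 0" "b = 0 \<Longrightarrow> b' = 0" "c = 0 \<Longrightarrow> c' = 0"
    and same_side: "0 \<le> (a' * N - a * N') * (b' * N - b * N')"
  shows "info (a' + b') (a + b) + info (b' + c') (b + c) + info (c' + a') (c + a)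
    \<le> info a' a + info b' b + info c' c + info N' N"
proof -
  let ?x = "a' * N - a * N'" and ?y = "b' * N - b * N'"
  let ?u = "a' * c - a * c'" and ?v = "b' * c - b * c'"
  have xy: "?x + ?y = ?u + ?v"
    by (simp add: N_def N'_def algebra_simps)
  have "info (b' + c') (b + c) + info (c' + a') (c + a) \<le> info c' c + info N' N"
  proof (cases "?x + ?y = 0")
    case True
    with same_side have "?x = 0" "?y = 0"
      by (smt (verit, best) mult_neg_pos mult_pos_neg)+
    hence par: "a' * N = a * N'" "b' * N = b * N'" by auto
    hence "c' * N = c * N'"
      by (simp add: N_def N'_def algebra_simps)
    show ?thesis
    proof (cases "N = 0")
      case True
      hence "a = 0" "b = 0" "c = 0" using nonneg by (auto simp: N_def)
      thus ?thesis using ac by (simp add: N'_def)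
    next
      case False
      hence N: "0 < N" using nonneg by (simp add: N_def)
      define t where "t = N' / N"
      have t: "a' = t * a" "b' = t * b" "c' = t * c"
        using par \<open>c' * N = c * N'\<close> N by (auto simp: t_def field_simps)
      have lin: "info (t * z) z = z * (t * ln t)" if "0 \<le> z" for z
        using that by (cases "z = 0") (auto simp: info_def)
      have "info (t * (b + c)) (b + c) + info (t * (c + a)) (c + a) =
            info (t * c) c + info (t * N) N"
        using nonneg N by (simp add: lin) (simp add: N_def algebra_simps)
      moreover have "b' + c' = t * (b + c)" "c' + a' = t * (c + a)" "N' = t * N"
        by (simp_all add: t N_def N'_def algebra_simps)
      ultimately show ?thesis
        by (simp only: t(3))
    qed
  next
    case False
    \<comment> \<open>The coefficients in the cone are quotients of two-by-two determinants of the vectors.\<close>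
    define x y u v s where "x = ?x" and "y = ?y" and "u = ?u" and "v = ?v" and "s = x + y"
    note defs = x_def y_def u_def v_def
    have s: "u + v = s" "s \<noteq> 0"
      using xy False by (simp_all add: s_def defs)
    have N: "0 < N"
      using False nonneg by (auto simp: N_def N'_def less_le ac)
    have sq: "0 \<le> x * s" "0 \<le> y * s"
      unfolding s_def using same_side by (simp_all add: distrib_left mult.commute defs)
    have uv: "u * N = x * c + a * s" "v * N = y * c + b * s"
      by (simp_all add: s_def defs N_def N'_def algebra_simps)
    have sq': "0 \<le> u * s" "0 \<le> v * s"
    proof -
      have "(u * s) * N = (u * N) * s" "(v * s) * N = (v * N) * s" by simp_all
      moreover have "(w * c + d * s) * s = c * (w * s) + d * s\<^sup>2" for w d
        by (simp add: power2_eq_square algebra_simps)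
      ultimately have "(u * s) * N = c * (x * s) + a * s\<^sup>2" "(v * s) * N = c * (y * s) + b * s\<^sup>2"
        unfolding uv by simp_all
      moreover have "0 \<le> c * (x * s) + a * s\<^sup>2" "0 \<le> c * (y * s) + b * s\<^sup>2"
        by (intro add_nonneg_nonneg mult_nonneg_nonneg zero_le_power2 sq nonneg)+
      ultimately have "0 \<le> (u * s) * N" "0 \<le> (v * s) * N" by simp_all
      thus "0 \<le> u * s" "0 \<le> v * s" using N by (simp_all add: zero_le_mult_iff)
    qed
    define \<alpha> \<gamma> where "\<alpha> = u / s" and "\<gamma> = y / s"
    have quot: "0 \<le> w / s" if "0 \<le> w * s" for w
      using that by (auto simp: zero_le_mult_iff zero_le_divide_iff)
    have "1 - \<alpha> = v / s" "1 - \<gamma> = x / s"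
      using s unfolding \<alpha>_def \<gamma>_def by (simp_all add: field_simps s_def)
    hence coeffs: "0 \<le> \<alpha>" "0 \<le> 1 - \<alpha>" "0 \<le> \<gamma>" "0 \<le> 1 - \<gamma>"
      using quot sq sq' by (simp_all add: \<alpha>_def \<gamma>_def)
    have dec: "\<alpha> * N' + \<gamma> * c' = c' + a'" "\<alpha> * N + \<gamma> * c = c + a"
    proof -
      have "u * N' + y * c' = (c' + a') * s" "u * N + y * c = (c + a) * s"
        by (simp_all add: s_def defs N_def N'_def algebra_simps)
      thus "\<alpha> * N' + \<gamma> * c' = c' + a'" "\<alpha> * N + \<gamma> * c = c + a"
        using s(2) by (simp_all add: \<alpha>_def \<gamma>_def add_divide_distrib[symmetric])
    qed
    have dec': "(1 - \<alpha>) * N' + (1 - \<gamma>) * c' = b' + c'" "(1 - \<alpha>) * N + (1 - \<gamma>) * c = b + c"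
      using dec by (simp_all add: N_def N'_def algebra_simps)
    have N0: "0 \<le> N" "0 \<le> N'" "N = 0 \<Longrightarrow> N' = 0"
      using nonneg ac by (auto simp: N_def N'_def)
    have "info (c' + a') (c + a) \<le> \<alpha> * info N' N + \<gamma> * info c' c"
      using info_convex_comb_le[of N' N c' c \<alpha> \<gamma>] N0 nonneg ac coeffs by (simp add: dec)
    moreover have "info (b' + c') (b + c) \<le> (1 - \<alpha>) * info N' N + (1 - \<gamma>) * info c' c"
      using info_convex_comb_le[of N' N c' c "1 - \<alpha>" "1 - \<gamma>"] N0 nonneg ac coeffs by (simp add: dec')
    ultimately show ?thesis by (simp add: algebra_simps)
  qed
  moreover have "info (a' + b') (a + b) \<le> info a' a + info b' b"
    using nonneg ac by (intro info_add_le) auto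
  ultimately show ?thesis by simp
qed

text \<open>
  Among three ratios two always lie on the same side of their weighted mean, so the previous
  lemma applies after a rotation.
\<close>

lemma info_hlawka:
  fixes a b c a' b' c' :: real
  assumes nonneg: "0 \<le> a" "0 \<le> b" "0 \<le> c" "0 \<le> a'" "0 \<le> b'" "0 \<le> c'"
    and ac: "a = 0 \<Longrightarrow> a' = 0" "b = 0 \<Longrightarrow> b' = 0" "c = 0 \<Longrightarrow> c' = 0"
  shows "info (a' + b') (a + b) + info (b' + c') (b + c) + info (c' + a') (c + a)
    \<le> info a' a + info b' b + info c' c + info (a' + b' + c') (a + b + c)"
proof -
  let ?N = "a + b + c" and ?N' = "a' + b' + c'"
  let ?x = "a' * ?N - a * ?N'" and ?y = "b' * ?N - b * ?N'" and ?z = "c' * ?N - c * ?N'"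
  consider "0 \<le> ?x * ?y" | "0 \<le> ?y * ?z" | "0 \<le> ?z * ?x"
    using linear[of 0 ?x] linear[of 0 ?y] linear[of 0 ?z]
    unfolding zero_le_mult_iff by blast
  thus ?thesis
  proof cases
    case 1
    thus ?thesis using info_hlawka_aux[of a b c a' b' c'] nonneg ac by simp
  next
    case 2
    thus ?thesis using info_hlawka_aux[of b c a b' c' a'] nonneg ac by (simp add: ac_simps)
  next
    case 3
    thus ?thesis using info_hlawka_aux[of c a b c' a' b'] nonneg ac by (simp add: ac_simps)
  qed
qed

section \<open>Averages over the suffixes of a random order\<close>

text \<open>
  In a uniformly random order of an \<open>n\<close>-element set, the probability that the suffix starting at
  a given element is a given \<open>b\<close>-element set containing that element.
\<close>

definition suffix_weight :: "nat \<Rightarrow> nat \<Rightarrow> real" where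
  "suffix_weight n b = fact (b - 1) * fact (n - b) / fact n"

text \<open>
  The expected value of \<open>\<Sum>\<^sub>B \<psi> B / |B|\<close> over the nonempty suffixes \<open>B\<close> of a uniformly random order
  of \<open>I\<close>. Written as a sum over sets, it can be manipulated without permutations.
\<close>

definition suffix_mean :: "'i set \<Rightarrow> ('i set \<Rightarrow> real) \<Rightarrow> real" where
  "suffix_mean I \<psi> = (\<Sum>B\<in>Pow I - {{}}. suffix_weight (card I) (card B) * \<psi> B)"

lemma suffix_weight_nonneg [simp]: "0 \<le> suffix_weight n b"
  by (simp add: suffix_weight_def)

lemma suffix_weight_rec:
  assumes "0 < b" "b \<le> n"
  shows "real n * suffix_weight n b = real (n - b) * suffix_weight (n - 1) b + (if b = n then 1 else 0)"
proof (cases "b = n")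
  case True
  thus ?thesis using assms by (simp add: suffix_weight_def fact_reduce field_simps)
next
  case False
  with assms have "fact n = real n * fact (n - 1)" "fact (n - b) = real (n - b) * fact (n - 1 - b)"
    by (simp_all add: fact_reduce)
  thus ?thesis using False assms by (simp add: suffix_weight_def)
qed

lemma suffix_weight_shift:
  assumes "0 < b" "b < n"
  shows "real (n - b) * suffix_weight n (b + 1) = real b * suffix_weight n b"
proof -
  have "fact b = real b * fact (b - 1)" "fact (n - b) = real (n - b) * fact (n - (b + 1))"
    using assms by (simp_all add: fact_reduce)
  thus ?thesis by (simp add: suffix_weight_def)
qed

text \<open>
  Condition on the first element of the order: the whole set is the longest suffix, and the
  others are the suffixes of a random order of the remaining elements.
\<close>

lemma suffix_mean_rec:
  assumes fin: "finite I" and ne: "I \<noteq> {}"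
  shows "real (card I) * suffix_mean I \<psi> = \<psi> I + (\<Sum>x\<in>I. suffix_mean (I - {x}) \<psi>)"
proof -
  let ?P = "Pow I - {{}}" and ?w = "\<lambda>B. suffix_weight (card I - 1) (card B) * \<psi> B"
  have finP: "finite ?P" using fin by simp
  have card_le: "0 < card B \<and> card B \<le> card I" if "B \<in> ?P" for B
    using that fin by (auto simp: card_gt_0_iff card_mono dest: finite_subset)
  have card_eq: "card B = card I \<longleftrightarrow> B = I" if "B \<in> ?P" for B
    using that fin by (auto dest: card_subset_eq)
  have "(\<Sum>x\<in>I. suffix_mean (I - {x}) \<psi>) = (\<Sum>x\<in>I. \<Sum>B | B \<in> ?P \<and> x \<notin> B. ?w B)"
  proof (intro sum.cong refl)
    fix x assume "x \<in> I"
    moreover from this have "Pow (I - {x}) - {{}} = {B. B \<in> ?P \<and> x \<notin> B}" by auto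
    ultimately show "suffix_mean (I - {x}) \<psi> = (\<Sum>B | B \<in> ?P \<and> x \<notin> B. ?w B)"
      by (simp add: suffix_mean_def)
  qed
  also have "\<dots> = (\<Sum>B\<in>?P. \<Sum>x | x \<in> I \<and> x \<notin> B. ?w B)"
    by (rule sum.swap_restrict[OF fin finP])
  also have "\<dots> = (\<Sum>B\<in>?P. real (card I - card B) * ?w B)"
  proof (intro sum.cong refl)
    fix B assume B: "B \<in> ?P"
    have "{x. x \<in> I \<and> x \<notin> B} = I - B" by auto
    moreover have "card (I - B) = card I - card B"
      using B fin by (intro card_Diff_subset) (auto dest: finite_subset)
    ultimately show "(\<Sum>x | x \<in> I \<and> x \<notin> B. ?w B) = real (card I - card B) * ?w B"
      by simp
  qed
  finally have rhs: "(\<Sum>x\<in>I. suffix_mean (I - {x}) \<psi>) = (\<Sum>B\<in>?P. real (card I - card B) * ?w B)" .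
  have "real (card I) * suffix_mean I \<psi> =
      (\<Sum>B\<in>?P. (real (card I) * suffix_weight (card I) (card B)) * \<psi> B)"
    by (simp add: suffix_mean_def sum_distrib_left mult.assoc)
  also have "\<dots> = (\<Sum>B\<in>?P. real (card I - card B) * ?w B + (if B = I then \<psi> I else 0))"
    by (intro sum.cong refl) (use card_le in \<open>auto simp: suffix_weight_rec card_eq algebra_simps\<close>)
  also have "\<dots> = (\<Sum>B\<in>?P. real (card I - card B) * ?w B) + \<psi> I"
    using finP ne by (simp add: sum.distrib)
  finally show ?thesis using rhs by simp
qed

lemma suffix_mean_empty [simp]: "suffix_mean {} \<psi> = 0"
  by (simp add: suffix_mean_def)

lemma suffix_mean_mono:
  assumes "\<And>B. B \<subseteq> I \<Longrightarrow> \<psi> B \<le> \<psi>' B"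
  shows "suffix_mean I \<psi> \<le> suffix_mean I \<psi>'"
  unfolding suffix_mean_def using assms by (intro sum_mono mult_left_mono) auto

lemma suffix_mean_additive:
  assumes "finite I"
  shows "suffix_mean I (\<lambda>B. sum h B) = sum h I"
  using assms
proof (induction "card I" arbitrary: I)
  case (Suc n)
  hence ne: "I \<noteq> {}" and n: "card I = Suc n" by auto
  have "real (card I) * suffix_mean I (\<lambda>B. sum h B) = sum h I + (\<Sum>x\<in>I. sum h (I - {x}))"
    using suffix_mean_rec[OF Suc.prems ne, of "\<lambda>B. sum h B"] Suc by simp
  also have "(\<Sum>x\<in>I. sum h (I - {x})) = (\<Sum>x\<in>I. sum h I - h x)"
    using Suc.prems by (intro sum.cong refl) (simp add: sum_diff1)
  also have "sum h I + \<dots> = real (card I) * sum h I"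
    by (simp add: sum_subtractf)
  finally show ?case using n by simp
qed auto

text \<open>
  Every set \<open>B\<close> arises \<open>|B|\<close> times as a set before a removal and \<open>|I| - |B|\<close> times as a set after
  one. By \<open>suffix_weight_shift\<close> the two contributions cancel, except for \<open>I\<close>, which never arises after
  a removal, and \<open>{}\<close>, which never arises before one.
\<close>

lemma suffix_mean_removal:
  assumes fin: "finite I" and ne: "I \<noteq> {}"
  shows "(\<Sum>e\<in>I. \<Sum>B | B \<subseteq> I \<and> e \<in> B. suffix_weight (card I) (card B) * (\<psi> B - \<psi> (B - {e})))
    = \<psi> I - \<psi> {}"
proof -
  let ?n = "card I" and ?w = "\<lambda>b. suffix_weight (card I) b"
  have n: "0 < ?n" using fin ne by (simp add: card_gt_0_iff)
  have finP: "finite (Pow I)" using fin by simp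
  have finB: "finite B" "card B \<le> ?n" if "B \<subseteq> I" for B
    using that fin by (auto intro: finite_subset card_mono)
  have up: "(\<Sum>e\<in>I. \<Sum>B | B \<subseteq> I \<and> e \<in> B. ?w (card B) * \<psi> B)
      = (\<Sum>B\<in>Pow I. real (card B) * ?w (card B) * \<psi> B)"
  proof -
    have "(\<Sum>e\<in>I. \<Sum>B | B \<in> Pow I \<and> e \<in> B. ?w (card B) * \<psi> B)
        = (\<Sum>B\<in>Pow I. \<Sum>e | e \<in> I \<and> e \<in> B. ?w (card B) * \<psi> B)"
      by (rule sum.swap_restrict[OF fin finP])
    also have "\<dots> = (\<Sum>B\<in>Pow I. real (card B) * ?w (card B) * \<psi> B)"
    proof (intro sum.cong refl)
      fix B assume "B \<in> Pow I"
      hence "{e. e \<in> I \<and> e \<in> B} = B" by auto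
      thus "(\<Sum>e | e \<in> I \<and> e \<in> B. ?w (card B) * \<psi> B) = real (card B) * ?w (card B) * \<psi> B"
        by simp
    qed
    finally show ?thesis by simp
  qed
  have down: "(\<Sum>e\<in>I. \<Sum>B | B \<subseteq> I \<and> e \<in> B. ?w (card B) * \<psi> (B - {e}))
      = (\<Sum>C\<in>Pow I. real (?n - card C) * ?w (card C + 1) * \<psi> C)"
  proof -
    have "(\<Sum>e\<in>I. \<Sum>B | B \<subseteq> I \<and> e \<in> B. ?w (card B) * \<psi> (B - {e}))
        = (\<Sum>e\<in>I. \<Sum>C | C \<in> Pow I \<and> e \<notin> C. ?w (card C + 1) * \<psi> C)"
    proof (rule sum.cong[OF refl])
      fix e assume "e \<in> I"
      have "card (B - {e}) + 1 = card B" if "B \<subseteq> I" "e \<in> B" for B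
        using finB[OF that(1)] card_Suc_Diff1[OF _ that(2)] by simp
      thus "(\<Sum>B | B \<subseteq> I \<and> e \<in> B. ?w (card B) * \<psi> (B - {e}))
          = (\<Sum>C | C \<in> Pow I \<and> e \<notin> C. ?w (card C + 1) * \<psi> C)"
        using \<open>e \<in> I\<close>
        by (intro sum.reindex_bij_witness[of _ "insert e" "\<lambda>B. B - {e}"]) auto
    qed
    also have "\<dots> = (\<Sum>C\<in>Pow I. \<Sum>e | e \<in> I \<and> e \<notin> C. ?w (card C + 1) * \<psi> C)"
      by (rule sum.swap_restrict[OF fin finP])
    also have "\<dots> = (\<Sum>C\<in>Pow I. real (?n - card C) * ?w (card C + 1) * \<psi> C)"
    proof (intro sum.cong refl)
      fix C assume C: "C \<in> Pow I"
      have "{e. e \<in> I \<and> e \<notin> C} = I - C" by auto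
      moreover have "card (I - C) = ?n - card C"
        using C finB by (intro card_Diff_subset) auto
      ultimately show "(\<Sum>e | e \<in> I \<and> e \<notin> C. ?w (card C + 1) * \<psi> C)
          = real (?n - card C) * ?w (card C + 1) * \<psi> C" by simp
    qed
    finally show ?thesis .
  qed
  have coeff: "real (card B) * ?w (card B) - real (?n - card B) * ?w (card B + 1)
      = (if B = I then 1 else 0) - (if B = {} then 1 else 0)" if "B \<subseteq> I" for B
  proof -
    consider "B = {}" | "B = I" | "B \<noteq> {}" "B \<noteq> I" by blast
    thus ?thesis
    proof cases
      case 1
      thus ?thesis using ne n by (simp add: suffix_weight_def fact_reduce)
    next
      case 2
      thus ?thesis using ne n by (simp add: suffix_weight_def fact_reduce)
    next
      case 3
      hence "0 < card B" "card B < ?n"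
        using that fin finB[OF that] by (auto simp: card_gt_0_iff psubset_card_mono)
      thus ?thesis using 3 suffix_weight_shift[of "card B" ?n] by simp
    qed
  qed
  have "(\<Sum>e\<in>I. \<Sum>B | B \<subseteq> I \<and> e \<in> B. ?w (card B) * (\<psi> B - \<psi> (B - {e})))
      = (\<Sum>B\<in>Pow I. real (card B) * ?w (card B) * \<psi> B)
        - (\<Sum>C\<in>Pow I. real (?n - card C) * ?w (card C + 1) * \<psi> C)"
    unfolding up[symmetric] down[symmetric] by (simp add: right_diff_distrib sum_subtractf)
  also have "\<dots> = (\<Sum>B\<in>Pow I. (if B = I then \<psi> I else 0) - (if B = {} then \<psi> {} else 0))"
    unfolding sum_subtractf[symmetric] left_diff_distrib[symmetric]
  proof (rule sum.cong[OF refl])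
    fix B assume "B \<in> Pow I"
    thus "(real (card B) * ?w (card B) - real (?n - card B) * ?w (card B + 1)) * \<psi> B
        = (if B = I then \<psi> I else 0) - (if B = {} then \<psi> {} else 0)"
      using coeff[of B] ne by auto
  qed
  also have "\<dots> = \<psi> I - \<psi> {}"
    using finP by (simp add: sum_subtractf)
  finally show ?thesis .
qed

definition log_suffix_sum :: "('i \<Rightarrow> real) \<Rightarrow> 'i list \<Rightarrow> real" where
  "log_suffix_sum q xs = (\<Sum>t<length xs. q (xs ! t) * ln (\<Sum>r=t..<length xs. q (xs ! r)))"

lemma log_suffix_sum_Cons:
  assumes "distinct (x # xs)"
  shows "log_suffix_sum q (x # xs) = q x * ln (sum q (set (x # xs))) + log_suffix_sum q xs"
proof -
  have "(\<Sum>r=Suc t..<Suc (length xs). q ((x # xs) ! r)) = (\<Sum>r=t..<length xs. q (xs ! r))" for t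
    by (simp only: sum.atLeast_Suc_lessThan_Suc_shift) (simp add: o_def)
  moreover have "(\<Sum>r=0..<length (x # xs). q ((x # xs) ! r)) = sum q (set (x # xs))"
    unfolding sum.distinct_set_conv_list[OF assms]
    by (simp only: sum_list_sum_nth length_map) (rule sum.cong[OF refl], simp del: list.map)
  ultimately show ?thesis
    unfolding log_suffix_sum_def length_Cons sum.lessThan_Suc_shift
    by (simp only: nth_Cons_0 nth_Cons_Suc length_Cons)
qed

lemma sum_permutations_log_suffix_sum:
  assumes "finite I"
  shows "(\<Sum>xs\<in>permutations_of_set I. log_suffix_sum q xs)
    = fact (card I) * suffix_mean I (\<lambda>B. xlnx (sum q B))"
  using assms
proof (induction "card I" arbitrary: I)
  case 0
  thus ?case by (simp add: log_suffix_sum_def)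
next
  case (Suc n)
  hence ne: "I \<noteq> {}" and n: "card I = Suc n" by auto
  let ?\<psi> = "\<lambda>B. xlnx (sum q B)"
  have "(\<Sum>xs\<in>permutations_of_set I. log_suffix_sum q xs)
      = (\<Sum>x\<in>I. \<Sum>xs\<in>(\<lambda>xs. x # xs) ` permutations_of_set (I - {x}). log_suffix_sum q xs)"
    unfolding permutations_of_set_nonempty[OF ne]
    using Suc.prems by (intro sum.UNION_disjoint) auto
  also have "\<dots> = (\<Sum>x\<in>I. \<Sum>xs\<in>permutations_of_set (I - {x}). log_suffix_sum q (x # xs))"
    by (simp add: sum.reindex)
  also have "\<dots> = (\<Sum>x\<in>I. \<Sum>xs\<in>permutations_of_set (I - {x}).
      q x * ln (sum q I) + log_suffix_sum q xs)"
  proof (intro sum.cong refl)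
    fix x xs assume x: "x \<in> I" and xs: "xs \<in> permutations_of_set (I - {x})"
    have "set (x # xs) = I" "distinct (x # xs)"
      using permutations_of_setD[OF xs] x by auto
    thus "log_suffix_sum q (x # xs) = q x * ln (sum q I) + log_suffix_sum q xs"
      using log_suffix_sum_Cons[of x xs q] by simp
  qed
  also have "\<dots> = (\<Sum>x\<in>I. fact n * (q x * ln (sum q I)) + fact n * suffix_mean (I - {x}) ?\<psi>)"
    using Suc n by (intro sum.cong refl) (simp add: sum.distrib)
  also have "\<dots> = fact n * (xlnx (sum q I) + (\<Sum>x\<in>I. suffix_mean (I - {x}) ?\<psi>))"
    by (simp add: sum.distrib sum_distrib_left[symmetric] sum_distrib_right[symmetric]
        distrib_left xlnx_def)
  also have "\<dots> = fact n * (real (card I) * suffix_mean I ?\<psi>)"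
    using suffix_mean_rec[OF Suc.prems ne, of ?\<psi>] by simp
  finally show ?case by (simp add: n mult_ac)
qed

lemma F_eq_suffix_mean:
  assumes "finite I"
  shows "F I q = suffix_mean I (\<lambda>B. xlnx (sum q B)) + complementary_entropy I q"
proof -
  have "(\<Sum>t<card I. q (xs ! t) * ln (\<Sum>r=t..<card I. q (xs ! r))) = log_suffix_sum q xs"
    if "xs \<in> permutations_of_set I" for xs
    using that by (simp add: log_suffix_sum_def length_finite_permutations_of_set)
  hence "measure_pmf.expectation (pmf_of_set (permutations_of_set I))
       (\<lambda>xs. \<Sum>t<card I. q (xs ! t) * ln (\<Sum>r=t..<card I. q (xs ! r)))
     = (\<Sum>xs\<in>permutations_of_set I. log_suffix_sum q xs) / card (permutations_of_set I)"
    using assms by (subst integral_pmf_of_set) (auto intro!: sum.cong)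
  thus ?thesis
    using assms by (simp add: F_def sum_permutations_log_suffix_sum)
qed

section \<open>Divergences of vectors on a finite index set\<close>

definition info_on :: "('i \<Rightarrow> real) \<Rightarrow> ('i \<Rightarrow> real) \<Rightarrow> 'i set \<Rightarrow> real" where
  "info_on q' q B = info (sum q' B) (sum q B)"

text \<open>
  Nonnegative vectors on a finite set, with \<open>q'\<close> vanishing wherever \<open>q\<close> does. The total masses are left
  free so that restrictions to subsets and vectors with an erased coordinate are instances.
\<close>

locale dominated =
  fixes I :: "'i set" and q q' :: "'i \<Rightarrow> real"
  assumes fin: "finite I"
    and nonneg: "\<And>i. i \<in> I \<Longrightarrow> 0 \<le> q i" "\<And>i. i \<in> I \<Longrightarrow> 0 \<le> q' i"
    and ac: "\<And>i. i \<in> I \<Longrightarrow> q i = 0 \<Longrightarrow> q' i = 0"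
begin

lemma sums:
  assumes "B \<subseteq> I"
  shows "0 \<le> sum q B" "0 \<le> sum q' B" "sum q B = 0 \<Longrightarrow> sum q' B = 0"
proof -
  show "0 \<le> sum q B" "0 \<le> sum q' B"
    using assms nonneg by (auto intro!: sum_nonneg)
  assume "sum q B = 0"
  hence "\<forall>i\<in>B. q i = 0"
    using assms fin nonneg by (subst (asm) sum_nonneg_eq_0_iff) (auto intro: finite_subset)
  thus "sum q' B = 0" using assms ac by (auto intro!: sum.neutral)
qed

lemma info_on_Un_le:
  assumes "B \<subseteq> I" "C \<subseteq> I" "B \<inter> C = {}"
  shows "info_on q' q (B \<union> C) \<le> info_on q' q B + info_on q' q C"
proof -
  have "finite B" "finite C" using assms fin by (auto intro: finite_subset)
  thus ?thesis unfolding info_on_def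
    using info_add_le[OF sums(2,1,3)[OF assms(1)] sums(2,1,3)[OF assms(2)]] assms(3)
    by (simp add: sum.union_disjoint)
qed

lemma info_on_le_sum:
  assumes "B \<subseteq> I"
  shows "info_on q' q B \<le> (\<Sum>i\<in>B. info_on q' q {i})"
proof -
  have "finite B" using assms fin by (rule finite_subset)
  thus ?thesis using assms
  proof (induction B)
    case empty thus ?case by (simp add: info_on_def)
  next
    case (insert x B)
    have "info_on q' q ({x} \<union> B) \<le> info_on q' q {x} + info_on q' q B"
      using insert by (intro info_on_Un_le) auto
    with insert show ?case by simp
  qed
qed

text \<open>
  For \<open>J = I\<close> and probability vectors this is nonnegativity of the divergence belonging to \<open>S\<close>,
  that is, concavity of \<open>S\<close>. By the Hlawka inequality the function \<open>\<theta>\<close> in the proof is subadditive on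
  disjoint subsets of \<open>J\<close>; compare its value at \<open>J\<close> with its values at the singletons.
\<close>

lemma sum_info_on_remove_le:
  assumes "J \<subseteq> I"
  shows "(\<Sum>i\<in>J. info_on q' q (J - {i}))
    \<le> (\<Sum>i\<in>J. info_on q' q {i}) + (real (card J) - 2) * info_on q' q J"
proof -
  let ?\<phi> = "info_on q' q"
  define \<theta> where "\<theta> B = ?\<phi> B - ?\<phi> (J - B) + ?\<phi> J" for B
  have finJ: "finite J" using assms fin by (rule finite_subset)
  have subadd: "\<theta> (B \<union> C) \<le> \<theta> B + \<theta> C" if "B \<subseteq> J" "C \<subseteq> J" "B \<inter> C = {}" for B C
  proof -
    define D where "D = J - (B \<union> C)"
    have sub: "B \<subseteq> I" "C \<subseteq> I" "D \<subseteq> I" using that assms by (auto simp: D_def)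
    have finBC: "finite B" "finite C" "finite D" using sub fin by (auto intro: finite_subset)
    have dis: "B \<inter> D = {}" "C \<inter> D = {}" "D \<inter> B = {}" by (auto simp: D_def)
    have "?\<phi> (B \<union> C) + ?\<phi> (C \<union> D) + ?\<phi> (D \<union> B) \<le> ?\<phi> B + ?\<phi> C + ?\<phi> D + ?\<phi> (B \<union> C \<union> D)"
      unfolding info_on_def
      using info_hlawka[OF sums(1)[OF sub(1)] sums(1)[OF sub(2)] sums(1)[OF sub(3)]
          sums(2)[OF sub(1)] sums(2)[OF sub(2)] sums(2)[OF sub(3)]
          sums(3)[OF sub(1)] sums(3)[OF sub(2)] sums(3)[OF sub(3)]] that(3) dis finBC
      by (simp add: sum.union_disjoint Int_Un_distrib2)
    moreover have "J - B = C \<union> D" "J - C = D \<union> B" "J - (B \<union> C) = D" "B \<union> C \<union> D = J"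
      using that by (auto simp: D_def)
    ultimately show ?thesis by (simp add: \<theta>_def)
  qed
  have "\<theta> B \<le> (\<Sum>i\<in>B. \<theta> {i})" if "B \<subseteq> J" for B
  proof -
    have "finite B" using that finJ by (rule finite_subset)
    thus ?thesis using that
    proof (induction B)
      case empty thus ?case by (simp add: \<theta>_def info_on_def)
    next
      case (insert x B)
      have "\<theta> ({x} \<union> B) \<le> \<theta> {x} + \<theta> B" using insert by (intro subadd) auto
      with insert show ?case by simp
    qed
  qed
  from this[of J] have "2 * ?\<phi> J \<le> (\<Sum>i\<in>J. \<theta> {i})"
    by (simp add: \<theta>_def info_on_def)
  also have "\<dots> = (\<Sum>i\<in>J. ?\<phi> {i}) - (\<Sum>i\<in>J. ?\<phi> (J - {i})) + real (card J) * ?\<phi> J"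
    by (simp add: \<theta>_def sum.distrib sum_subtractf)
  finally show ?thesis by (simp add: algebra_simps)
qed

text \<open>
  Induction along \<open>suffix_mean_rec\<close>. The terms \<open>info_on (J - {x})\<close> that the induction hypothesis
  leaves are summed by \<open>sum_info_on_remove_le\<close>, and the resulting bound reproduces itself exactly.
\<close>

lemma suffix_mean_info_on_le:
  assumes "J \<subseteq> I"
  shows "suffix_mean J (info_on q' q) \<le> ((\<Sum>i\<in>J. info_on q' q {i}) + info_on q' q J) / 2"
  using assms
proof (induction "card J" arbitrary: J)
  case 0
  hence "J = {}" using fin by (metis card_0_eq finite_subset)
  thus ?case by (simp add: info_on_def)
next
  case (Suc n)
  let ?\<phi> = "info_on q' q"
  let ?K = "\<Sum>i\<in>J. ?\<phi> {i}"
  have finJ: "finite J" using Suc.prems fin by (rule finite_subset)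
  have n: "card J = Suc n" and ne: "J \<noteq> {}" using Suc by auto
  have "real (card J) * suffix_mean J ?\<phi> = ?\<phi> J + (\<Sum>x\<in>J. suffix_mean (J - {x}) ?\<phi>)"
    by (rule suffix_mean_rec[OF finJ ne])
  also have "(\<Sum>x\<in>J. suffix_mean (J - {x}) ?\<phi>)
      \<le> (\<Sum>x\<in>J. ((\<Sum>i\<in>J - {x}. ?\<phi> {i}) + ?\<phi> (J - {x})) / 2)"
    using Suc n finJ by (intro sum_mono Suc.hyps(1)) auto
  also have "\<dots> = (\<Sum>x\<in>J. (?K - ?\<phi> {x} + ?\<phi> (J - {x})) / 2)"
    using finJ by (intro sum.cong refl) (simp add: sum_diff1)
  also have "\<dots> = ((real (card J) - 1) * ?K + (\<Sum>x\<in>J. ?\<phi> (J - {x}))) / 2"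
    by (simp add: sum_divide_distrib[symmetric] sum.distrib sum_subtractf algebra_simps)
  also have "\<dots> \<le> ((real (card J) - 1) * ?K + (?K + (real (card J) - 2) * ?\<phi> J)) / 2"
    using sum_info_on_remove_le[OF Suc.prems] by simp
  also have "?\<phi> J + \<dots> = real (card J) * ((?K + ?\<phi> J) / 2)"
    by (simp add: field_simps)
  finally show ?case using n by (simp del: of_nat_Suc)
qed

end

definition rel_entropy :: "'i set \<Rightarrow> ('i \<Rightarrow> real) \<Rightarrow> ('i \<Rightarrow> real) \<Rightarrow> real" where
  "rel_entropy I q' q = (\<Sum>i\<in>I. info_on q' q {i})"

definition binary_div :: "real \<Rightarrow> real \<Rightarrow> real" where
  "binary_div a b = info a b + info (1 - a) (1 - b)"

text \<open>
  For probability vectors, the Bregman divergence of \<open>-S\<close>, where \<open>S\<close> is \<open>bethe_term\<close>. The sum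
  subtracted is the divergence of the complements, since \<open>q\<close> has mass \<open>1 - q i\<close> on \<open>I - {i}\<close>.
\<close>

definition bethe_div :: "'i set \<Rightarrow> ('i \<Rightarrow> real) \<Rightarrow> ('i \<Rightarrow> real) \<Rightarrow> real" where
  "bethe_div I q' q = rel_entropy I q' q - (\<Sum>i\<in>I. info_on q' q (I - {i}))"

text \<open>
  For probability vectors, the Bregman divergence of \<open>-R\<close>, where \<open>R = S + F\<close> is \<open>order_term\<close>.
\<close>

definition order_div :: "'i set \<Rightarrow> ('i \<Rightarrow> real) \<Rightarrow> ('i \<Rightarrow> real) \<Rightarrow> real" where
  "order_div I q' q = rel_entropy I q' q - suffix_mean I (info_on q' q)"

definition bethe_term :: "'i set \<Rightarrow> ('i \<Rightarrow> real) \<Rightarrow> real" where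
  "bethe_term I q = shannon_entropy I q - complementary_entropy I q"

text \<open>
  This is \<open>S + F\<close>: the expected cost \<open>- ln (q i / s)\<close> of predicting the outcome \<open>i\<close> when everything that
  precedes it in a uniformly random order has been excluded, so that mass \<open>s\<close> is left.
\<close>

definition order_term :: "'i set \<Rightarrow> ('i \<Rightarrow> real) \<Rightarrow> real" where
  "order_term I q = shannon_entropy I q + suffix_mean I (\<lambda>B. xlnx (sum q B))"

text \<open>
  Bound each \<open>info_on\<close> by the sum over its singletons; the suffix mean of an additive set function is
  its value on the whole set.
\<close>

lemma (in dominated) order_div_homogeneous_nonneg: "0 \<le> order_div I q' q"
proof -
  have "suffix_mean I (info_on q' q) \<le> suffix_mean I (\<lambda>B. \<Sum>i\<in>B. info_on q' q {i})"
    by (intro suffix_mean_mono info_on_le_sum)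
  thus ?thesis
    using fin by (simp add: order_div_def rel_entropy_def suffix_mean_additive)
qed

locale dominated_prob = dominated +
  assumes sum1: "sum q I = 1" "sum q' I = 1"
begin

lemma info_on_total: "info_on q' q I = 0"
  by (simp add: info_on_def sum1)

lemma info_on_remove: "i \<in> I \<Longrightarrow> info_on q' q (I - {i}) = info (1 - q' i) (1 - q i)"
  using fin sum1 by (simp add: info_on_def sum_diff1)

lemma bethe_div_nonneg: "0 \<le> bethe_div I q' q"
  using sum_info_on_remove_le[OF subset_refl]
  by (simp add: bethe_div_def rel_entropy_def info_on_total)

lemma rel_entropy_le_order_div: "rel_entropy I q' q \<le> 2 * order_div I q' q"
  using suffix_mean_info_on_le[OF subset_refl]
  by (simp add: order_div_def rel_entropy_def info_on_total)

lemma binary_div_le_rel_entropy: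
  assumes "i \<in> I"
  shows "binary_div (q' i) (q i) \<le> rel_entropy I q' q"
proof -
  have "info_on q' q (I - {i}) \<le> (\<Sum>j\<in>I - {i}. info_on q' q {j})"
    by (intro info_on_le_sum) auto
  thus ?thesis
    using assms fin by (simp add: rel_entropy_def info_on_remove binary_div_def sum_diff1)
      (simp add: info_on_def)
qed

text \<open>
  The form used for moving divergence along the edges of a tree.
\<close>

lemma bethe_div_eq:
  "bethe_div I q' q = 2 * rel_entropy I q' q - (\<Sum>i\<in>I. binary_div (q' i) (q i))"
proof -
  have "(\<Sum>i\<in>I. binary_div (q' i) (q i)) = (\<Sum>i\<in>I. info_on q' q {i} + info_on q' q (I - {i}))"
    by (intro sum.cong refl) (simp add: binary_div_def info_on_remove, simp add: info_on_def)
  thus ?thesis by (simp add: bethe_div_def rel_entropy_def sum.distrib)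
qed

text \<open>
  Let \<open>q\<^sub>0\<close> be \<open>q\<close> with the coordinate \<open>e\<close> erased, an unnormalized vector that still dominates \<open>q'\<close>.
  The divergence from \<open>q\<^sub>0\<close> is nonnegative, and the asserted bound is exactly the difference between the
  two divergences. It is linear in \<open>q'\<close>, so that it can be averaged over \<open>q'\<close>.
\<close>

lemma order_div_ge_of_excluded:
  assumes e: "e \<in> I" "q' e = 0"
  shows "(\<Sum>B | B \<subseteq> I \<and> e \<in> B. suffix_weight (card I) (card B) *
      (sum q' B * (ln (sum q B) - ln (sum q (B - {e}))))) \<le> order_div I q' q"
proof -
  define q\<^sub>0 where "q\<^sub>0 = q(e := 0)"
  have dom: "dominated I q\<^sub>0 q'"
    using fin nonneg ac e by unfold_locales (auto simp: q\<^sub>0_def split: if_splits)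
  interpret D0: dominated I q\<^sub>0 q' by (rule dom)
  have single: "info_on q' q\<^sub>0 {i} = info_on q' q {i}" for i
    using e by (auto simp: info_on_def q\<^sub>0_def)
  have sum\<^sub>0: "sum q\<^sub>0 B = sum q (B - {e})" if "B \<subseteq> I" for B
  proof -
    have "finite B" using that fin by (rule finite_subset)
    hence "sum q\<^sub>0 B = sum q\<^sub>0 (B - {e})"
      by (intro sum.mono_neutral_right) (auto simp: q\<^sub>0_def)
    also have "\<dots> = sum q (B - {e})" by (intro sum.cong) (auto simp: q\<^sub>0_def)
    finally show ?thesis .
  qed
  have gap: "info_on q' q\<^sub>0 B - info_on q' q B
      = (if e \<in> B then sum q' B * (ln (sum q B) - ln (sum q (B - {e}))) else 0)"
    if B: "B \<subseteq> I" for B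
  proof (cases "e \<in> B \<and> sum q' B \<noteq> 0")
    case True
    have pos: "0 < sum q' B" using True sums(2)[OF B] by simp
    have pos2: "0 < sum q B" using True sums(1,3)[OF B] by (auto simp: less_le)
    have pos0: "0 < sum q\<^sub>0 B" using True D0.sums(1,3)[OF B] by (auto simp: less_le)
    show ?thesis
      using True pos pos2 pos0 sum\<^sub>0[OF B] by (simp add: info_on_def info_def ln_div algebra_simps)
  next
    case False
    thus ?thesis using sum\<^sub>0[OF B] by (auto simp: info_on_def)
  qed
  have "0 \<le> order_div I q' q\<^sub>0" by (rule D0.order_div_homogeneous_nonneg)
  hence "suffix_mean I (info_on q' q\<^sub>0) - suffix_mean I (info_on q' q) \<le> order_div I q' q"
    by (simp add: order_div_def rel_entropy_def single)
  moreover have "suffix_mean I (info_on q' q\<^sub>0) - suffix_mean I (info_on q' q)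
     = (\<Sum>B\<in>Pow I - {{}}. suffix_weight (card I) (card B) * (info_on q' q\<^sub>0 B - info_on q' q B))"
    by (simp add: suffix_mean_def sum_subtractf right_diff_distrib)
  moreover have "\<dots> = (\<Sum>B | B \<subseteq> I \<and> e \<in> B. suffix_weight (card I) (card B) *
      (sum q' B * (ln (sum q B) - ln (sum q (B - {e})))))"
    using fin by (intro sum.mono_neutral_cong_right) (auto simp: gap)
  ultimately show ?thesis by simp
qed

lemma order_div_point:
  assumes e: "e \<in> I" "q' e = 1"
  shows "order_div I q' q = - ln (q e)
    + (\<Sum>B | B \<subseteq> I \<and> e \<in> B. suffix_weight (card I) (card B) * ln (sum q B))"
proof -
  have "sum q' (I - {e}) = 0" using e fin sum1 by (simp add: sum_diff1)
  hence zero: "q' i = 0" if "i \<in> I" "i \<noteq> e" for i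
    using that fin nonneg by (subst (asm) sum_nonneg_eq_0_iff) auto
  have mass: "sum q' B = (if e \<in> B then 1 else 0)" if "B \<subseteq> I" for B
  proof -
    have "finite B" using that fin by (rule finite_subset)
    moreover have "sum q' B = (\<Sum>i\<in>B. if i = e then 1 else 0)"
      using that zero e by (intro sum.cong) auto
    ultimately show ?thesis by simp
  qed
  have val: "info_on q' q B = (if e \<in> B then - ln (sum q B) else 0)" if B: "B \<subseteq> I" for B
  proof (cases "e \<in> B")
    case True
    have "sum q B \<noteq> 0" using sums(3)[OF B] mass[OF B] True by auto
    hence "0 < sum q B" using sums(1)[OF B] by simp
    thus ?thesis using True mass[OF B] by (simp add: info_on_def info_def ln_div)
  qed (simp add: info_on_def mass[OF B])
  have "rel_entropy I q' q = (\<Sum>i\<in>I. if i = e then - ln (q e) else 0)"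
    unfolding rel_entropy_def by (intro sum.cong refl) (auto simp: val)
  hence "rel_entropy I q' q = - ln (q e)" using fin e by simp
  moreover have "suffix_mean I (info_on q' q)
      = (\<Sum>B | B \<subseteq> I \<and> e \<in> B. suffix_weight (card I) (card B) * - ln (sum q B))"
    unfolding suffix_mean_def using fin by (intro sum.mono_neutral_cong_right) (auto simp: val)
  ultimately show ?thesis by (simp add: order_div_def sum_negf)
qed

end

section \<open>Short paths in a graph of large girth\<close>

definition is_path :: "'a set set \<Rightarrow> 'a list \<Rightarrow> bool" where
  "is_path E xs \<longleftrightarrow> xs \<noteq> [] \<and> distinct xs \<and> successively (\<lambda>x y. {x, y} \<in> E) xs"

lemma is_path_appendD:
  assumes "is_path E (xs @ ys)"
  shows "xs \<noteq> [] \<Longrightarrow> is_path E xs" "ys \<noteq> [] \<Longrightarrow> is_path E ys"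
  using assms by (auto simp: is_path_def successively_append_iff)

lemma is_cycleI:
  assumes "3 \<le> length zs" "distinct zs" "successively (\<lambda>x y. {x, y} \<in> E) zs"
    and "{last zs, hd zs} \<in> E"
  shows "is_cycle E zs"
  unfolding is_cycle_def
proof (intro conjI allI impI)
  fix i assume i: "i < length zs"
  show "{zs ! i, zs ! (Suc i mod length zs)} \<in> E"
  proof (cases "Suc i < length zs")
    case True
    thus ?thesis using successively_nth[OF assms(3)] by simp
  next
    case False
    hence "Suc i = length zs" using i by simp
    hence "zs ! i = last zs" "zs ! 0 = hd zs" "Suc i mod length zs = 0"
      using i by (cases zs; auto simp: last_conv_nth hd_conv_nth)+
    thus ?thesis using assms(4) by simp
  qed
qed (use assms in auto)

text \<open>
  Two different paths with the same ends contain a cycle: if they share no inner vertex they form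
  one together, and otherwise they can be cut at a shared inner vertex, where one of the two pairs
  of pieces still differs.
\<close>

lemma is_path_unique:
  assumes girth: "enat g \<le> girth E"
    and "is_path E xs" "is_path E ys" "hd xs = hd ys" "last xs = last ys"
    and "length xs + length ys < g + 2"
  shows "xs = ys"
  using assms(2-)
proof (induction "length xs + length ys" arbitrary: xs ys rule: less_induct)
  case less
  note px = less.prems(1) and py = less.prems(2) and hd_eq = less.prems(3) and last_eq = less.prems(4)
  have triv: "zs = [z]" if "is_path E zs" "hd zs = z" "last zs = z" for z zs
  proof -
    from that obtain zs' where zs: "zs = z # zs'" by (cases zs) (auto simp: is_path_def)
    with that have "zs' = []"
      by (metis distinct.simps(2) is_path_def last_ConsR last_in_set)
    thus ?thesis using zs by simp
  qed
  show ?case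
  proof (cases "hd xs = last xs")
    case True
    thus ?thesis using triv[OF px refl] triv[OF py refl] hd_eq last_eq by simp
  next
    case False
    then obtain a b xs' where xs: "xs = a # xs' @ [b]"
      using px by (cases xs; cases "tl xs" rule: rev_cases) (auto simp: is_path_def)
    from False hd_eq last_eq obtain a' b' ys' where ys: "ys = a' # ys' @ [b']"
      using py by (cases ys; cases "tl ys" rule: rev_cases) (auto simp: is_path_def)
    have ab: "a' = a" "b' = b" using hd_eq last_eq xs ys by auto
    show ?thesis
    proof (cases "set xs' \<inter> set ys' = {}")
      case True
      show ?thesis
      proof (cases "xs' = [] \<and> ys' = []")
        case True
        thus ?thesis using xs ys ab by simp
      next
        case False
        let ?zs = "a # xs' @ b # rev ys'"
        have len: "3 \<le> length ?zs" using False by (cases xs'; cases ys') auto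
        have "is_cycle E ?zs"
        proof (rule is_cycleI[OF len])
          show "distinct ?zs"
            using px py True xs ys ab by (auto simp: is_path_def)
          have "successively (\<lambda>x y. {x, y} \<in> E) (rev ys)"
            using py unfolding successively_rev by (simp add: is_path_def insert_commute)
          hence succ: "successively (\<lambda>x y. {x, y} \<in> E) (b # rev ys' @ [a])"
            using ys ab by simp
          hence "successively (\<lambda>x y. {x, y} \<in> E) (b # rev ys')"
            by (metis append_Cons successively_append_iff)
          moreover have "successively (\<lambda>x y. {x, y} \<in> E) ((a # xs') @ [b])"
            using px xs by (simp add: is_path_def)
          ultimately show "successively (\<lambda>x y. {x, y} \<in> E) ?zs"
            using successively_append_iff[of _ "a # xs'" "b # rev ys'"]
              successively_append_iff[of _ "a # xs'" "[b]"] by auto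
          show "{last ?zs, hd ?zs} \<in> E"
            using succ successively_append_iff[of _ "b # rev ys'" "[a]"] by simp
        qed
        hence "girth E \<le> enat (length ?zs)"
          unfolding girth_def by (intro INF_lower) auto
        with girth have "g \<le> length ?zs"
          by (metis enat_ord_simps(1) order_trans)
        thus ?thesis using less.prems(5) xs ys by simp
      qed
    next
      case False
      then obtain c where c: "c \<in> set xs'" "c \<in> set ys'" by auto
      obtain x1 x2 where x: "xs' = x1 @ c # x2" using split_list[OF c(1)] by auto
      obtain y1 y2 where y: "ys' = y1 @ c # y2" using split_list[OF c(2)] by auto
      have X: "xs = (a # x1 @ [c]) @ (x2 @ [b])" "xs = (a # x1) @ (c # x2 @ [b])"
        using xs x by auto
      have Y: "ys = (a # y1 @ [c]) @ (y2 @ [b])" "ys = (a # y1) @ (c # y2 @ [b])"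
        using ys y ab by auto
      have "is_path E (a # x1 @ [c])" "is_path E (a # y1 @ [c])"
        using px py is_path_appendD(1)[of E "a # _ @ [c]"] unfolding X(1) Y(1) by blast+
      moreover have "is_path E (c # x2 @ [b])" "is_path E (c # y2 @ [b])"
        using px py is_path_appendD(2)[of E _ "c # _ @ [b]"] unfolding X(2) Y(2) by blast+
      moreover have "length (a # x1 @ [c]) + length (a # y1 @ [c]) < length xs + length ys"
        "length (c # x2 @ [b]) + length (c # y2 @ [b]) < length xs + length ys"
        unfolding X(1) Y(1) by simp_all
      ultimately have "a # x1 @ [c] = a # y1 @ [c]" "c # x2 @ [b] = c # y2 @ [b]"
        using less.prems(5) less.hyps[of "a # x1 @ [c]" "a # y1 @ [c]"]
          less.hyps[of "c # x2 @ [b]" "c # y2 @ [b]"] by auto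
      thus ?thesis using X(1) Y(1) by simp
    qed
  qed
qed

text \<open>
  Paths that start with the edge \<open>m\<close>, traversed in either direction, and continue by \<open>r\<close> more
  edges. They are listed backwards: the head is the vertex reached, the first two entries form the
  last edge, and the last two entries are the endpoints of \<open>m\<close>. For \<open>r = 0\<close> both endpoints of \<open>m\<close> are
  reached, and the last edge is \<open>m\<close> itself.
\<close>

primrec branches :: "'a set set \<Rightarrow> 'a set \<Rightarrow> nat \<Rightarrow> 'a list set" where
  "branches E m 0 = {[v, w] | v w. m = {v, w}}"
| "branches E m (Suc r) = {z # xs | z xs. xs \<in> branches E m r \<and> {z, hd xs} \<in> E \<and> z \<notin> set xs}"

lemma length_branches: "xs \<in> branches E m r \<Longrightarrow> length xs = r + 2"
  by (induction r arbitrary: xs) auto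

lemma branchesE:
  assumes "xs \<in> branches E m r" "m \<in> E" "card m = 2"
  obtains zs v w where "xs = zs @ [v, w]" "m = {v, w}" "length zs = r" "is_path E xs"
proof -
  have "\<exists>zs v w. xs = zs @ [v, w] \<and> m = {v, w} \<and> length zs = r \<and> is_path E xs"
    using assms(1)
  proof (induction r arbitrary: xs)
    case 0
    then obtain v w where "xs = [v, w]" "m = {v, w}" by auto
    moreover from this have "v \<noteq> w" using assms(3) by auto
    ultimately show ?case using assms(2) by (auto simp: is_path_def)
  next
    case (Suc r)
    then obtain z ys where ys: "xs = z # ys" "ys \<in> branches E m r" "{z, hd ys} \<in> E" "z \<notin> set ys"
      by auto
    with Suc.IH obtain zs v w where zs: "ys = zs @ [v, w]" "m = {v, w}" "length zs = r" "is_path E ys"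
      by blast
    have "is_path E xs"
      using ys zs(4) by (auto simp: is_path_def successively_Cons)
    thus ?case using ys zs by (intro exI[of _ "z # zs"] exI[of _ v] exI[of _ w]) auto
  qed
  thus ?thesis using that by blast
qed

lemma finite_branches:
  assumes "finite (\<Union>E)" "m \<in> E"
  shows "finite (branches E m r)"
proof (induction r)
  case 0
  have "branches E m 0 \<subseteq> (\<lambda>(v, w). [v, w]) ` (m \<times> m)" by auto
  moreover have "finite m" using assms by (meson Union_upper finite_subset)
  ultimately show ?case by (meson finite_SigmaI finite_imageI finite_subset)
next
  case (Suc r)
  have "branches E m (Suc r) \<subseteq> (\<lambda>(z, xs). z # xs) ` (\<Union>E \<times> branches E m r)" by auto
  thus ?case using Suc assms by (meson finite_SigmaI finite_imageI finite_subset)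
qed

text \<open>
  Cut off the last entry of one or both paths, so that both end at the same endpoint of \<open>m\<close>. The
  remaining paths are short enough to coincide. If \<open>m\<close> was traversed in opposite directions this is
  absurd, as one path would meet an endpoint of \<open>m\<close> twice.
\<close>

lemma branches_hd_inj:
  assumes girth: "enat g \<le> girth E" and m: "m \<in> E" "card m = 2"
    and xs: "xs \<in> branches E m r" and ys: "ys \<in> branches E m r'"
    and "hd xs = hd ys" and r: "r + r' + 2 \<le> g"
  shows "xs = ys"
proof -
  obtain zs v w where 1: "xs = zs @ [v, w]" "m = {v, w}" "length zs = r" "is_path E xs"
    using branchesE[OF xs m] .
  obtain zs' v' w' where 2: "ys = zs' @ [v', w']" "m = {v', w'}" "length zs' = r'" "is_path E ys"
    using branchesE[OF ys m] .
  have pre: "is_path E (zs @ [v])" "is_path E (zs' @ [v'])"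
    using 1 2 is_path_appendD(1)[of E "_ @ [_]" "[_]"] by force+
  have hds: "hd (zs @ [v]) = hd xs" "hd (zs' @ [v']) = hd ys"
    using 1 2 by (simp_all add: hd_append)
  show ?thesis
  proof (cases "w = w'")
    case True
    hence "v = v'" using 1 2 by (auto simp: doubleton_eq_iff)
    have "zs @ [v] = zs' @ [v']"
      by (rule is_path_unique[OF girth pre]) (use hds assms \<open>v = v'\<close> 1 2 in simp_all)
    thus ?thesis using True 1 2 by simp
  next
    case False
    hence w: "w' = v" "v' = w" using 1 2 by (auto simp: doubleton_eq_iff)
    have "xs = zs' @ [v']"
      by (rule is_path_unique[OF girth 1(4) pre(2)]) (use hds assms w 1 2 in simp_all)
    hence "zs' = zs @ [v]" using 1 w by simp
    hence False using 2 w by (simp add: is_path_def)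
    thus ?thesis ..
  qed
qed

text \<open>
  An edge back to an earlier vertex of the path would close a short cycle.
\<close>

lemma incident_hd_branch:
  assumes girth: "enat g \<le> girth E" and m: "m \<in> E" "card m = 2"
    and card2: "\<And>e. e \<in> E \<Longrightarrow> card e = 2"
    and xs: "xs \<in> branches E m r" and r: "r + 2 < g"
  shows "incident E (hd xs) = insert {hd xs, xs ! 1} ((\<lambda>z. {z, hd xs}) ` {z. {z, hd xs} \<in> E \<and> z \<notin> set xs})"
    and "{hd xs, xs ! 1} \<in> E"
proof -
  obtain zs v w where 1: "xs = zs @ [v, w]" "length zs = r" "is_path E xs"
    using branchesE[OF xs m] .
  obtain u y ws where u: "xs = u # y # ws"
    using 1(1) by (cases zs; cases "tl zs") auto
  show uy: "{hd xs, xs ! 1} \<in> E" using u 1(3) by (simp add: is_path_def)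
  have "e = {u, y} \<or> (\<exists>z. e = {z, u} \<and> z \<notin> set xs)" if e: "e \<in> E" "u \<in> e" for e
  proof -
    obtain z where z: "e = {z, u}" "z \<noteq> u"
      using card2[OF e(1)] e(2) by (auto simp: card_2_iff)
    have "z \<notin> set ws"
    proof
      assume "z \<in> set ws"
      then obtain a b where ws: "ws = a @ z # b" using split_list by metis
      have "is_path E ((u # y # a @ [z]) @ b)" using 1(3) u ws by simp
      from is_path_appendD(1)[OF this] have "is_path E (u # y # a @ [z])" by simp
      moreover have "is_path E [u, z]" using z e by (simp add: is_path_def insert_commute)
      moreover have "length (u # y # a @ [z]) + length [u, z] < g + 2"
        using r 1(1,2) u ws by (auto dest: arg_cong[of _ _ length])
      ultimately have "u # y # a @ [z] = [u, z]"
        by (intro is_path_unique[OF girth]) auto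
      thus False by simp
    qed
    thus ?thesis using z u by (auto simp: insert_commute)
  qed
  thus "incident E (hd xs) = insert {hd xs, xs ! 1}
      ((\<lambda>z. {z, hd xs}) ` {z. {z, hd xs} \<in> E \<and> z \<notin> set xs})"
    using uy u by (auto simp: incident_def)
qed

section \<open>Laws on perfect matchings\<close>

locale bipartite_girth =
  fixes L R :: "'a set" and E :: "'a set set" and k :: nat
  assumes bip: "bipartite_graph L R E" and girth: "enat (2 * k) \<le> girth E" and k: "2 \<le> k"
begin

abbreviation "V \<equiv> L \<union> R"
abbreviation "PM \<equiv> perfect_matchings V E"
abbreviation "n \<equiv> real (card L)"

lemma finite_L: "finite L" and finite_R: "finite R" and LR: "L \<inter> R = {}"
  using bip by (auto simp: bipartite_graph_def)

lemma finite_V: "finite V"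
  using finite_L finite_R by simp

lemma edgeE:
  assumes "e \<in> E"
  obtains u v where "u \<in> L" "v \<in> R" "e = {u, v}" "u \<noteq> v"
  using assms bip by (fastforce simp: bipartite_graph_def)

lemma edge_subset_V: "e \<in> E \<Longrightarrow> e \<subseteq> V"
  by (erule edgeE) auto

lemma card_edge: "e \<in> E \<Longrightarrow> card e = 2"
  by (erule edgeE) auto

lemma finite_E: "finite E"
  using edge_subset_V finite_V by (intro finite_subset[of E "Pow V"]) auto

lemma finite_incident: "finite (incident E u)"
  using finite_E by (simp add: incident_def)

lemma PM_subset: "M \<in> PM \<Longrightarrow> M \<subseteq> E"
  by (simp add: perfect_matchings_def)

lemma finite_PM: "finite PM"
  using PM_subset finite_E by (intro finite_subset[of PM "Pow E"]) auto

lemma PM_cover: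
  assumes "M \<in> PM" "v \<in> V"
  shows "card {e \<in> incident E v. e \<in> M} = 1"
proof -
  from assms have "\<exists>!e. e \<in> M \<and> v \<in> e" by (simp add: perfect_matchings_def)
  then obtain e where e: "e \<in> M" "v \<in> e" "\<And>f. f \<in> M \<Longrightarrow> v \<in> f \<Longrightarrow> f = e" by blast
  have "{e \<in> incident E v. e \<in> M} = {e}"
    using e(1,2) PM_subset[OF assms(1)] e(3) unfolding incident_def by blast
  thus ?thesis by simp
qed

lemma PM_unique:
  assumes "M \<in> PM" "v \<in> V" "e \<in> M" "f \<in> M" "v \<in> e" "v \<in> f"
  shows "e = f"
proof -
  have "\<exists>!e. e \<in> M \<and> v \<in> e" using assms(1,2) by (simp add: perfect_matchings_def)
  thus ?thesis using assms(3-6) by blast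
qed

lemma card_PM:
  assumes M: "M \<in> PM"
  shows "card M = card L"
proof -
  have finM: "finite M" using PM_subset[OF M] finite_E by (rule finite_subset)
  have "card M = (\<Sum>e\<in>M. card {v. v \<in> L \<and> v \<in> e})"
  proof -
    have "card {v. v \<in> L \<and> v \<in> e} = 1" if e: "e \<in> M" for e
    proof -
      obtain u v where uv: "u \<in> L" "v \<in> R" "e = {u, v}"
        using edgeE[of e] PM_subset[OF M] e by blast
      hence "{v. v \<in> L \<and> v \<in> e} = {u}" using LR by auto
      thus ?thesis by simp
    qed
    thus ?thesis by simp
  qed
  also have "\<dots> = (\<Sum>v\<in>L. card {e. e \<in> M \<and> v \<in> e})"
    using sum.swap_restrict[OF finM finite_L, of "\<lambda>_ _. 1::nat" "\<lambda>e v. v \<in> e"] by simp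
  also have "\<dots> = (\<Sum>v\<in>L. 1)"
  proof (intro sum.cong refl)
    fix v assume "v \<in> L"
    moreover have "{e. e \<in> M \<and> v \<in> e} = {e \<in> incident E v. e \<in> M}"
      using PM_subset[OF M] by (auto simp: incident_def)
    ultimately show "card {e. e \<in> M \<and> v \<in> e} = 1" using PM_cover[OF M] by simp
  qed
  finally show ?thesis by simp
qed

lemma sum_incident_twice: "(\<Sum>u\<in>V. \<Sum>e\<in>incident E u. h e) = 2 * (\<Sum>e\<in>E. h e :: real)"
proof -
  have "(\<Sum>u\<in>V. \<Sum>e\<in>incident E u. h e) = (\<Sum>e\<in>E. \<Sum>u | u \<in> V \<and> u \<in> e. h e)"
    unfolding incident_def
    using sum.swap_restrict[OF finite_V finite_E, of "\<lambda>u e. h e" "\<lambda>u e. u \<in> e"] .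
  also have "\<dots> = (\<Sum>e\<in>E. 2 * h e)"
  proof (intro sum.cong refl)
    fix e assume "e \<in> E"
    moreover from this have "{u. u \<in> V \<and> u \<in> e} = e" using edge_subset_V by auto
    ultimately show "(\<Sum>u | u \<in> V \<and> u \<in> e. h e) = 2 * h e" by (simp add: card_edge)
  qed
  finally show ?thesis by (simp add: sum_distrib_left)
qed

text \<open>
  The vertices at distance at most one from the edge \<open>m\<close>: every endpoint of \<open>m\<close> is adjacent to the
  other one.
\<close>

definition near :: "'a set \<Rightarrow> 'a set" where
  "near m = {u \<in> V. \<exists>z\<in>m. {u, z} \<in> E}"

text \<open>
  The functional \<open>Phi\<close>, with each edge term split between the two endpoints.
\<close>

definition potential :: "('a set \<Rightarrow> real) \<Rightarrow> real" where
  "potential p = (\<Sum>u\<in>V. (1/2 - 1 / real k) * bethe_term (incident E u) p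
                        + 1 / real k * order_term (incident E u) p)"

lemma Phi_eq_potential: "Phi (2 * k) V E p = potential p"
proof -
  let ?h = "\<lambda>e. - p e * ln (p e) + (1 - p e) * ln (1 - p e)"
  let ?A = "\<Sum>u\<in>V. bethe_term (incident E u) p" and ?B = "\<Sum>u\<in>V. order_term (incident E u) p"
  have "bethe_term (incident E u) p = (\<Sum>e\<in>incident E u. ?h e)" for u
    unfolding bethe_term_def shannon_entropy_def complementary_entropy_def
    by (simp only: sum.distrib mult_minus_left sum_negf minus_minus diff_minus_eq_add)
  hence "?A = (\<Sum>u\<in>V. \<Sum>e\<in>incident E u. ?h e)" by (simp only:)
  hence A: "?A = 2 * bethe_entropy E p"
    unfolding bethe_entropy_def by (simp only: sum_incident_twice)
  have "F (incident E u) p = order_term (incident E u) p - bethe_term (incident E u) p" for u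
    using F_eq_suffix_mean[OF finite_incident, of u p]
    by (simp add: order_term_def bethe_term_def)
  hence "(\<Sum>u\<in>V. F (incident E u) p) = ?B - ?A" by (simp only: sum_subtractf)
  hence "Phi (2 * k) V E p = ?A / 2 + 1 / real k * (?B - ?A)"
    using A by (simp add: Phi_def)
  also have "\<dots> = (1/2 - 1 / real k) * ?A + 1 / real k * ?B"
    by (simp add: left_diff_distrib right_diff_distrib)
  also have "\<dots> = potential p"
    by (simp only: potential_def sum.distrib sum_distrib_left)
  finally show ?thesis .
qed

text \<open>
  Laws on perfect matchings are plain weight functions, so that conditioning on a null event needs
  no special treatment: its result is then multiplied by zero.
\<close>

definition law :: "('a set set \<Rightarrow> real) \<Rightarrow> bool" where
  "law x \<longleftrightarrow> (\<forall>M\<in>PM. 0 \<le> x M) \<and> sum x PM = 1"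

definition prob :: "('a set set \<Rightarrow> real) \<Rightarrow> 'a set \<Rightarrow> real" where
  "prob x e = (\<Sum>M | M \<in> PM \<and> e \<in> M. x M)"

definition joint :: "('a set set \<Rightarrow> real) \<Rightarrow> 'a set \<Rightarrow> 'a set \<Rightarrow> real" where
  "joint x m f = (\<Sum>M | M \<in> PM \<and> m \<in> M \<and> f \<in> M. x M)"

definition condition :: "('a set set \<Rightarrow> real) \<Rightarrow> 'a set \<Rightarrow> 'a set set \<Rightarrow> real" where
  "condition x m M = (if m \<in> M then x M / prob x m else 0)"

section \<open>Conditioning on one edge\<close>

context
  fixes x :: "'a set set \<Rightarrow> real"
  assumes law: "law x"
begin

lemma law_nonneg: "M \<in> PM \<Longrightarrow> 0 \<le> x M"
  using law by (simp add: law_def)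

lemma prob_nonneg: "0 \<le> prob x e"
  unfolding prob_def using law_nonneg by (intro sum_nonneg) auto

lemma joint_nonneg: "0 \<le> joint x m f"
  unfolding joint_def using law_nonneg by (intro sum_nonneg) auto

lemma joint_self: "joint x m m = prob x m"
  by (simp add: joint_def prob_def)

lemma joint_le: "joint x m f \<le> prob x m" "joint x m f \<le> prob x f"
  unfolding joint_def prob_def using law_nonneg finite_PM by (auto intro!: sum_mono2)

lemma joint_disjoint:
  assumes "v \<in> V" "v \<in> m" "v \<in> f" "m \<noteq> f"
  shows "joint x m f = 0"
proof -
  have "{M. M \<in> PM \<and> m \<in> M \<and> f \<in> M} = {}" using assms PM_unique by blast
  thus ?thesis by (simp only: joint_def sum.empty)
qed

lemma sum_incident_joint:
  assumes "z \<in> V"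
  shows "(\<Sum>m\<in>incident E z. joint x m f) = prob x f"
proof -
  have "(\<Sum>m\<in>incident E z. joint x m f)
      = (\<Sum>m\<in>incident E z. \<Sum>M | M \<in> {M \<in> PM. f \<in> M} \<and> m \<in> M. x M)"
    unfolding joint_def by (intro sum.cong refl) auto
  also have "\<dots> = (\<Sum>M\<in>{M \<in> PM. f \<in> M}. \<Sum>m | m \<in> incident E z \<and> m \<in> M. x M)"
    using finite_PM by (intro sum.swap_restrict[OF finite_incident]) auto
  also have "\<dots> = (\<Sum>M\<in>{M \<in> PM. f \<in> M}. x M)"
    using PM_cover[OF _ assms] by (intro sum.cong refl) auto
  finally show ?thesis by (simp add: prob_def)
qed

lemma sum_incident_prob:
  assumes "z \<in> V"
  shows "(\<Sum>m\<in>incident E z. prob x m) = 1"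
proof -
  have "(\<Sum>m\<in>incident E z. prob x m) = (\<Sum>M\<in>PM. \<Sum>m | m \<in> incident E z \<and> m \<in> M. x M)"
    unfolding prob_def by (rule sum.swap_restrict[OF finite_incident finite_PM])
  also have "\<dots> = (\<Sum>M\<in>PM. x M)"
    using PM_cover[OF _ assms] by (intro sum.cong refl) auto
  finally show ?thesis using law by (simp add: law_def)
qed

lemma sum_edges_weighted: "(\<Sum>m\<in>E. \<Sum>M | M \<in> A \<and> m \<in> M. h M) = n * (\<Sum>M\<in>A. h M :: real)"
  if "A \<subseteq> PM"
proof -
  have "(\<Sum>m\<in>E. \<Sum>M | M \<in> A \<and> m \<in> M. h M) = (\<Sum>M\<in>A. \<Sum>m | m \<in> E \<and> m \<in> M. h M)"
    by (rule sum.swap_restrict[OF finite_E finite_subset[OF that finite_PM]])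
  also have "\<dots> = (\<Sum>M\<in>A. n * h M)"
  proof (intro sum.cong refl)
    fix M assume "M \<in> A"
    hence M: "M \<in> PM" using that by auto
    hence "{m. m \<in> E \<and> m \<in> M} = M" using PM_subset by blast
    thus "(\<Sum>m | m \<in> E \<and> m \<in> M. h M) = n * h M" using card_PM[OF M] by simp
  qed
  finally show ?thesis by (simp add: sum_distrib_left)
qed

lemma sum_edges_joint: "(\<Sum>m\<in>E. joint x m f) = n * prob x f"
proof -
  have "(\<Sum>m\<in>E. joint x m f) = (\<Sum>m\<in>E. \<Sum>M | M \<in> {M \<in> PM. f \<in> M} \<and> m \<in> M. x M)"
    unfolding joint_def by (intro sum.cong refl) auto
  also have "\<dots> = n * (\<Sum>M\<in>{M \<in> PM. f \<in> M}. x M)"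
    by (rule sum_edges_weighted) auto
  finally show ?thesis by (simp add: prob_def)
qed

lemma sum_edges_prob: "(\<Sum>m\<in>E. prob x m) = n"
  using sum_edges_weighted[of PM x] law by (simp add: prob_def law_def)

lemma prob_condition: "prob x m * prob (condition x m) f = joint x m f"
proof (cases "prob x m = 0")
  case True
  thus ?thesis using joint_le(1)[of m f] joint_nonneg[of m f] by simp
next
  case False
  have "prob (condition x m) f = (\<Sum>M | M \<in> PM \<and> m \<in> M \<and> f \<in> M. x M / prob x m)"
    unfolding prob_def[of "condition x m"] using finite_PM
    by (intro sum.mono_neutral_cong_right) (auto simp: condition_def)
  thus ?thesis using False by (simp add: joint_def sum_divide_distrib[symmetric])
qed

lemma law_condition:
  assumes "0 < prob x m"
  shows "law (condition x m)"
proof -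
  have "sum (condition x m) PM = (\<Sum>M | M \<in> PM \<and> m \<in> M. x M / prob x m)"
    using finite_PM by (intro sum.mono_neutral_cong_right) (auto simp: condition_def)
  hence "sum (condition x m) PM = 1"
    using assms by (simp add: sum_divide_distrib[symmetric] prob_def[symmetric])
  thus ?thesis using assms law_nonneg by (simp add: law_def condition_def)
qed

lemma prob_condition_self: "0 < prob x m \<Longrightarrow> prob (condition x m) m = 1"
  using prob_condition[of m m] by (simp add: joint_self)

text \<open>
  Reveal the matching edge at a uniformly random left vertex. Summing over all edges counts each
  matching once for each of its \<open>n\<close> edges.
\<close>

lemma entropy_chain:
  "n * shannon_entropy PM x
    = (\<Sum>m\<in>E. - xlnx (prob x m) + prob x m * shannon_entropy PM (condition x m))"
proof -
  have "- xlnx (prob x m) + prob x m * shannon_entropy PM (condition x m)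
      = (\<Sum>M | M \<in> PM \<and> m \<in> M. - xlnx (x M))" for m
  proof (cases "prob x m = 0")
    case True
    have "x M = 0" if "M \<in> PM" "m \<in> M" for M
      using True that finite_PM law_nonneg unfolding prob_def
      by (subst (asm) sum_nonneg_eq_0_iff) auto
    thus ?thesis using True by (simp add: xlnx_def)
  next
    case False
    hence pos: "0 < prob x m" using prob_nonneg[of m] by simp
    have "prob x m * shannon_entropy PM (condition x m)
        = - (\<Sum>M | M \<in> PM \<and> m \<in> M. x M * ln (x M / prob x m))"
      unfolding shannon_entropy_def mult_minus_right sum_distrib_left using finite_PM pos
      by (intro arg_cong[of _ _ uminus] sum.mono_neutral_cong_right) (auto simp: condition_def)
    also have "(\<Sum>M | M \<in> PM \<and> m \<in> M. x M * ln (x M / prob x m))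
        = (\<Sum>M | M \<in> PM \<and> m \<in> M. xlnx (x M) - x M * ln (prob x m))"
    proof (intro sum.cong refl)
      fix M assume "M \<in> {M. M \<in> PM \<and> m \<in> M}"
      hence "0 \<le> x M" using law_nonneg by auto
      thus "x M * ln (x M / prob x m) = xlnx (x M) - x M * ln (prob x m)"
        using pos by (cases "x M = 0") (auto simp: xlnx_def ln_div algebra_simps)
    qed
    also have "\<dots> = (\<Sum>M | M \<in> PM \<and> m \<in> M. xlnx (x M)) - xlnx (prob x m)"
      by (simp add: sum_subtractf sum_distrib_right[symmetric] prob_def[symmetric] xlnx_def)
    finally show ?thesis by (simp add: sum_negf)
  qed
  hence "(\<Sum>m\<in>E. - xlnx (prob x m) + prob x m * shannon_entropy PM (condition x m))
      = n * (\<Sum>M\<in>PM. - xlnx (x M))"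
    using sum_edges_weighted[of PM "\<lambda>M. - xlnx (x M)"] by simp
  thus ?thesis by (simp add: shannon_entropy_def xlnx_def sum_negf)
qed

lemma dominated_incident:
  assumes "0 < prob x m" "u \<in> V"
  shows "dominated_prob (incident E u) (prob x) (prob (condition x m))"
proof
  show "finite (incident E u)" by (rule finite_incident)
  show "0 \<le> prob x i" "0 \<le> prob (condition x m) i" for i
    using prob_nonneg bipartite_girth.prob_nonneg[OF bipartite_girth_axioms law_condition[OF assms(1)]] by auto
  show "prob (condition x m) i = 0" if "prob x i = 0" for i
    using that prob_condition[of m i] joint_le(2)[of m i] joint_nonneg[of m i] assms(1) by auto
  show "sum (prob x) (incident E u) = 1"
    by (rule sum_incident_prob[OF assms(2)])
  show "sum (prob (condition x m)) (incident E u) = 1"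
    by (rule bipartite_girth.sum_incident_prob[OF bipartite_girth_axioms law_condition[OF assms(1)] assms(2)])
qed


text \<open>
  The masses of \<open>B\<close> under the conditional marginals average to its mass under \<open>prob x\<close>, so the linear part
  of the divergence averages out and only the values of \<open>xlnx\<close> remain. The next lemmas apply
  this to each set occurring in the functionals.
\<close>

lemma average_info:
  assumes "finite B"
  shows "(\<Sum>m\<in>E. prob x m * info_on (prob (condition x m)) (prob x) B)
    = (\<Sum>m\<in>E. prob x m * xlnx (sum (prob (condition x m)) B)) - n * xlnx (sum (prob x) B)"
proof -
  let ?s = "sum (prob x) B" and ?s' = "\<lambda>m. sum (prob (condition x m)) B"
  have mass: "prob x m * ?s' m = (\<Sum>f\<in>B. joint x m f)" for m
    by (simp add: sum_distrib_left prob_condition)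
  have "prob x m * info_on (prob (condition x m)) (prob x) B
      = prob x m * xlnx (?s' m) - (\<Sum>f\<in>B. joint x m f) * ln ?s" for m
  proof (cases "prob x m = 0")
    case True
    thus ?thesis using mass[of m] by simp
  next
    case False
    hence pos: "0 < prob x m" using prob_nonneg[of m] by simp
    have "?s' m = 0" if "?s = 0"
    proof -
      have "\<forall>f\<in>B. prob x f = 0"
        using that assms prob_nonneg by (subst (asm) sum_nonneg_eq_0_iff) auto
      hence "\<forall>f\<in>B. joint x m f = 0"
        using joint_le(2)[of m] joint_nonneg[of m] by (metis order_antisym)
      thus ?thesis using mass[of m] pos by simp
    qed
    moreover have "0 \<le> ?s" "0 \<le> ?s' m"
      using prob_nonneg bipartite_girth.prob_nonneg[OF bipartite_girth_axioms law_condition[OF pos]]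
      by (auto intro!: sum_nonneg)
    ultimately have "info_on (prob (condition x m)) (prob x) B = xlnx (?s' m) - ?s' m * ln ?s"
      unfolding info_on_def by (intro info_eq_xlnx) auto
    thus ?thesis using mass[of m] by (simp add: right_diff_distrib)
  qed
  moreover have "(\<Sum>m\<in>E. \<Sum>f\<in>B. joint x m f) = n * ?s"
    by (subst sum.swap) (simp add: sum_edges_joint sum_distrib_left)
  ultimately show ?thesis
    by (simp add: sum_subtractf sum_distrib_right[symmetric] xlnx_def)
qed

lemma average_rel_entropy:
  "(\<Sum>m\<in>E. prob x m * rel_entropy (incident E u) (prob (condition x m)) (prob x))
    = n * shannon_entropy (incident E u) (prob x)
      - (\<Sum>m\<in>E. prob x m * shannon_entropy (incident E u) (prob (condition x m)))"
proof -
  have "(\<Sum>m\<in>E. prob x m * rel_entropy (incident E u) (prob (condition x m)) (prob x))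
      = (\<Sum>e\<in>incident E u. \<Sum>m\<in>E. prob x m * info_on (prob (condition x m)) (prob x) {e})"
    unfolding rel_entropy_def sum_distrib_left by (rule sum.swap)
  also have "\<dots> = (\<Sum>e\<in>incident E u. \<Sum>m\<in>E. prob x m * xlnx (prob (condition x m) e))
      - n * (\<Sum>e\<in>incident E u. xlnx (prob x e))"
    by (simp add: average_info sum_subtractf sum_distrib_left)
  also have "(\<Sum>e\<in>incident E u. \<Sum>m\<in>E. prob x m * xlnx (prob (condition x m) e))
      = (\<Sum>m\<in>E. prob x m * (\<Sum>e\<in>incident E u. xlnx (prob (condition x m) e)))"
    unfolding sum_distrib_left by (rule sum.swap)
  finally show ?thesis
    by (simp add: shannon_entropy_def xlnx_def sum_negf)
qed

lemma average_bethe_div: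
  assumes u: "u \<in> V"
  shows "(\<Sum>m\<in>E. prob x m * bethe_div (incident E u) (prob (condition x m)) (prob x))
    = n * bethe_term (incident E u) (prob x)
      - (\<Sum>m\<in>E. prob x m * bethe_term (incident E u) (prob (condition x m)))"
proof -
  let ?I = "incident E u"
  have comp: "complementary_entropy ?I (prob y) = - (\<Sum>e\<in>?I. xlnx (sum (prob y) (?I - {e})))"
    if "law y" for y
  proof -
    have "sum (prob y) (?I - {e}) = 1 - prob y e" if "e \<in> ?I" for e
      using that finite_incident bipartite_girth.sum_incident_prob[OF bipartite_girth_axioms \<open>law y\<close> u]
      by (simp add: sum_diff1)
    thus ?thesis by (simp add: complementary_entropy_def xlnx_def)
  qed
  have "(\<Sum>m\<in>E. prob x m * (\<Sum>e\<in>?I. info_on (prob (condition x m)) (prob x) (?I - {e})))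
      = (\<Sum>e\<in>?I. \<Sum>m\<in>E. prob x m * info_on (prob (condition x m)) (prob x) (?I - {e}))"
    unfolding sum_distrib_left by (rule sum.swap)
  also have "\<dots> = (\<Sum>e\<in>?I. \<Sum>m\<in>E. prob x m * xlnx (sum (prob (condition x m)) (?I - {e})))
      - n * (\<Sum>e\<in>?I. xlnx (sum (prob x) (?I - {e})))"
    using finite_incident by (simp add: average_info sum_subtractf sum_distrib_left)
  also have "(\<Sum>e\<in>?I. \<Sum>m\<in>E. prob x m * xlnx (sum (prob (condition x m)) (?I - {e})))
      = (\<Sum>m\<in>E. prob x m * (\<Sum>e\<in>?I. xlnx (sum (prob (condition x m)) (?I - {e}))))"
    unfolding sum_distrib_left by (rule sum.swap)
  also have "\<dots> = (\<Sum>m\<in>E. prob x m * - complementary_entropy ?I (prob (condition x m)))"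
  proof (intro sum.cong refl)
    fix m
    show "prob x m * (\<Sum>e\<in>?I. xlnx (sum (prob (condition x m)) (?I - {e})))
        = prob x m * - complementary_entropy ?I (prob (condition x m))"
      using comp[OF law_condition[of m]] prob_nonneg[of m]
      by (cases "prob x m = 0") auto
  qed
  finally have "(\<Sum>m\<in>E. prob x m * (\<Sum>e\<in>?I. info_on (prob (condition x m)) (prob x) (?I - {e})))
      = n * complementary_entropy ?I (prob x)
        - (\<Sum>m\<in>E. prob x m * complementary_entropy ?I (prob (condition x m)))"
    by (simp add: comp[OF law] sum_negf)
  thus ?thesis
    using average_rel_entropy[of u]
    by (simp add: bethe_div_def bethe_term_def right_diff_distrib sum_subtractf)
qed

lemma average_order_div:
  "(\<Sum>m\<in>E. prob x m * order_div (incident E u) (prob (condition x m)) (prob x))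
    = n * order_term (incident E u) (prob x)
      - (\<Sum>m\<in>E. prob x m * order_term (incident E u) (prob (condition x m)))"
proof -
  let ?I = "incident E u" and ?w = "\<lambda>B. suffix_weight (card (incident E u)) (card B)"
  have swap: "(\<Sum>m\<in>E. prob x m * suffix_mean ?I (\<psi> m))
      = (\<Sum>B\<in>Pow ?I - {{}}. ?w B * (\<Sum>m\<in>E. prob x m * \<psi> m B))" for \<psi>
    unfolding suffix_mean_def sum_distrib_left
    by (subst sum.swap) (simp add: mult_ac)
  have "(\<Sum>m\<in>E. prob x m * suffix_mean ?I (info_on (prob (condition x m)) (prob x)))
      = (\<Sum>B\<in>Pow ?I - {{}}. ?w B *
          ((\<Sum>m\<in>E. prob x m * xlnx (sum (prob (condition x m)) B)) - n * xlnx (sum (prob x) B)))"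
    unfolding swap using finite_incident
    by (intro sum.cong refl) (auto simp: average_info finite_subset)
  also have "\<dots> = (\<Sum>m\<in>E. prob x m * suffix_mean ?I (\<lambda>B. xlnx (sum (prob (condition x m)) B)))
      - n * suffix_mean ?I (\<lambda>B. xlnx (sum (prob x) B))"
    unfolding swap
    by (simp add: suffix_mean_def right_diff_distrib sum_subtractf sum_distrib_left mult_ac)
  finally show ?thesis
    using average_rel_entropy[of u]
    by (simp add: order_div_def order_term_def right_diff_distrib distrib_left sum_subtractf sum.distrib)
qed


section \<open>Divergence far from a conditioned edge\<close>

context
  fixes m :: "'a set"
  assumes m: "m \<in> E" and pos: "0 < prob x m"
begin

abbreviation "p' \<equiv> prob (condition x m)"
abbreviation "edge_div e \<equiv> binary_div (p' e) (prob x e)"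
abbreviation "BD u \<equiv> bethe_div (incident E u) p' (prob x)"
abbreviation "OD u \<equiv> order_div (incident E u) p' (prob x)"

lemma branch_hd_edge: "xs \<in> branches E m r \<Longrightarrow> {hd xs, xs ! 1} \<in> E"
proof -
  assume xs: "xs \<in> branches E m r"
  obtain zs v w where 1: "xs = zs @ [v, w]" "is_path E xs"
    using branchesE[OF xs m card_edge[OF m]] .
  then obtain u y ws where u: "xs = u # y # ws"
    by (cases zs; cases "tl zs") auto
  thus ?thesis using 1 by (simp add: is_path_def)
qed

lemma branch_hd_in_V: "xs \<in> branches E m r \<Longrightarrow> hd xs \<in> V"
  using branch_hd_edge edge_subset_V by blast

text \<open>
  Short branches reach distinct vertices, so a sum over branches is a sum over vertices.
\<close>

lemma sum_branches_le:
  assumes S: "S \<subseteq> {..<k}" and W: "finite W"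
    and heads: "\<And>r xs. r \<in> S \<Longrightarrow> xs \<in> branches E m r \<Longrightarrow> hd xs \<in> W"
    and f: "\<And>u. u \<in> W \<Longrightarrow> 0 \<le> (f u :: real)"
  shows "(\<Sum>r\<in>S. \<Sum>xs\<in>branches E m r. f (hd xs)) \<le> (\<Sum>u\<in>W. f u)"
proof -
  have finE: "finite (\<Union>E)" using edge_subset_V finite_V by (meson Sup_least finite_subset)
  have finS: "finite S" using S by (rule finite_subset) simp
  have "(\<Sum>r\<in>S. \<Sum>xs\<in>branches E m r. f (hd xs)) = (\<Sum>(r, xs)\<in>Sigma S (branches E m). f (hd xs))"
    using finS finite_branches[OF finE m] by (intro sum.Sigma) auto
  also have "\<dots> = (\<Sum>u\<in>(\<lambda>(r, xs). hd xs) ` Sigma S (branches E m). f u)"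
  proof (subst sum.reindex)
    show "inj_on (\<lambda>(r, xs). hd xs) (Sigma S (branches E m))"
    proof (rule inj_onI, clarify)
      fix r xs r' ys
      assume *: "r \<in> S" "xs \<in> branches E m r" "r' \<in> S" "ys \<in> branches E m r'" "hd xs = hd ys"
      have "r < k" "r' < k" using * S by auto
      hence "xs = ys"
        by (intro branches_hd_inj[OF girth m card_edge[OF m] *(2,4,5)]) simp
      moreover have "length xs = r + 2" "length ys = r' + 2"
        using length_branches *(2,4) by blast+
      ultimately show "r = r' \<and> xs = ys" by simp
    qed
  qed (auto intro: sum.cong)
  also have "\<dots> \<le> (\<Sum>u\<in>W. f u)"
    using W heads f by (intro sum_mono2) auto
  finally show ?thesis .
qed

text \<open>
  At the vertex reached by a branch, \<open>bethe_div_eq\<close> and \<open>binary_div_le_rel_entropy\<close> bound the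
  divergence of the last edge by \<open>bethe_div\<close> and the divergences of the other edges there. These
  edges are precisely the last edges of the branches that are one step longer.
\<close>

lemma branch_step:
  assumes r: "r + 2 < 2 * k"
  shows "(\<Sum>xs\<in>branches E m r. edge_div {hd xs, xs ! 1})
    \<le> (\<Sum>xs\<in>branches E m r. BD (hd xs)) + (\<Sum>xs\<in>branches E m (Suc r). edge_div {hd xs, xs ! 1})"
proof -
  have finE: "finite (\<Union>E)" using edge_subset_V finite_V by (meson Sup_least finite_subset)
  define ext where "ext xs = {z. {z, hd xs} \<in> E \<and> z \<notin> set xs}" for xs
  have fin_ext: "finite (ext xs)" for xs
    using finE by (rule rev_finite_subset) (auto simp: ext_def)
  have one: "edge_div {hd xs, xs ! 1} \<le> BD (hd xs) + (\<Sum>z\<in>ext xs. edge_div {z, hd xs})"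
    if xs: "xs \<in> branches E m r" for xs
  proof -
    let ?u = "hd xs" and ?e = "{hd xs, xs ! 1}"
    interpret D: dominated_prob "incident E ?u" "prob x" p'
      by (rule dominated_incident[OF pos branch_hd_in_V[OF xs]])
    have inc: "incident E ?u = insert ?e ((\<lambda>z. {z, ?u}) ` ext xs)"
      using incident_hd_branch(1)[OF girth m card_edge[OF m] card_edge xs r] by (simp add: ext_def)
    obtain zs v w where "xs = zs @ [v, w]" using branchesE[OF xs m card_edge[OF m]] .
    hence len: "1 < length xs" by simp
    hence "xs ! 1 \<in> set xs" "hd xs \<in> set xs" by (intro nth_mem hd_in_set; force)+
    hence "?e \<notin> (\<lambda>z. {z, ?u}) ` ext xs"
      by (auto simp: ext_def doubleton_eq_iff)
    moreover have "inj_on (\<lambda>z. {z, ?u}) (ext xs)"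
      by (auto simp: inj_on_def doubleton_eq_iff)
    ultimately have "(\<Sum>e\<in>incident E ?u. edge_div e) = edge_div ?e + (\<Sum>z\<in>ext xs. edge_div {z, ?u})"
      unfolding inc using fin_ext by (simp add: sum.reindex)
    moreover have "edge_div ?e \<le> rel_entropy (incident E ?u) p' (prob x)"
      by (rule D.binary_div_le_rel_entropy) (simp add: inc)
    ultimately show ?thesis using D.bethe_div_eq by simp
  qed
  have "branches E m (Suc r) = (\<lambda>(xs, z). z # xs) ` (SIGMA xs:branches E m r. ext xs)"
    by (auto simp: ext_def image_iff)
  moreover have "inj_on (\<lambda>(xs, z). z # xs) (SIGMA xs:branches E m r. ext xs)"
    by (auto simp: inj_on_def)
  ultimately have "(\<Sum>xs\<in>branches E m (Suc r). edge_div {hd xs, xs ! 1})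
      = (\<Sum>(xs, z)\<in>(SIGMA xs:branches E m r. ext xs). edge_div {z, xs ! 0})"
    by (simp add: sum.reindex case_prod_unfold)
  also have "\<dots> = (\<Sum>xs\<in>branches E m r. \<Sum>z\<in>ext xs. edge_div {z, xs ! 0})"
    using finite_branches[OF finE m] fin_ext by (intro sum.Sigma[symmetric]) auto
  also have "\<dots> = (\<Sum>xs\<in>branches E m r. \<Sum>z\<in>ext xs. edge_div {z, hd xs})"
  proof (intro sum.cong refl)
    fix xs z assume "xs \<in> branches E m r"
    then obtain zs v w where "xs = zs @ [v, w]" using branchesE[OF _ m card_edge[OF m]] by metis
    thus "edge_div {z, xs ! 0} = edge_div {z, hd xs}" by (simp add: hd_conv_nth)
  qed
  finally show ?thesis
    using sum_mono[OF one, of "branches E m r"] by (simp add: sum.distrib)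
qed

lemma branch_sum_start: "(\<Sum>xs\<in>branches E m 0. edge_div {hd xs, xs ! 1}) = 2 * - ln (prob x m)"
proof -
  obtain v w where vw: "v \<in> L" "w \<in> R" "m = {v, w}" "v \<noteq> w" by (rule edgeE[OF m])
  have "branches E m 0 = {[v, w], [w, v]}" using vw by (auto simp: doubleton_eq_iff)
  moreover have "edge_div m = - ln (prob x m)"
    using prob_condition_self[OF pos] pos by (simp add: binary_div_def info_def ln_div)
  ultimately show ?thesis using vw by (simp add: insert_commute)
qed

lemma branch_sum_bound:
  assumes "\<rho> < k"
  shows "2 * - ln (prob x m) \<le> (\<Sum>r<\<rho>. \<Sum>xs\<in>branches E m r. BD (hd xs))
    + (\<Sum>xs\<in>branches E m \<rho>. edge_div {hd xs, xs ! 1})"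
  using assms
proof (induction \<rho>)
  case 0
  thus ?case by (simp only: branch_sum_start) simp
next
  case (Suc r)
  have "r + 2 < 2 * k" using Suc.prems by simp
  from branch_step[OF this] Suc show ?case by (simp del: branches.simps)
qed

text \<open>
  What has not been absorbed before level \<open>\<rho>\<close> is a sum of binary divergences of edges, each at most the
  relative entropy at the vertex reached and hence at most \<open>2 OD\<close>.
\<close>

lemma branch_level_bound:
  assumes \<rho>: "\<rho> < k"
  shows "- ln (prob x m) \<le> (\<Sum>u\<in>V. BD u) / 2 + (\<Sum>xs\<in>branches E m \<rho>. OD (hd xs))"
proof -
  have "(\<Sum>r<\<rho>. \<Sum>xs\<in>branches E m r. BD (hd xs)) \<le> (\<Sum>u\<in>V. BD u)"
    using \<rho> branch_hd_in_V finite_V dominated_prob.bethe_div_nonneg[OF dominated_incident[OF pos]]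
    by (intro sum_branches_le) auto
  moreover have "(\<Sum>xs\<in>branches E m \<rho>. edge_div {hd xs, xs ! 1})
      \<le> (\<Sum>xs\<in>branches E m \<rho>. 2 * OD (hd xs))"
  proof (rule sum_mono)
    fix xs assume xs: "xs \<in> branches E m \<rho>"
    interpret D: dominated_prob "incident E (hd xs)" "prob x" p'
      by (rule dominated_incident[OF pos branch_hd_in_V[OF xs]])
    have "edge_div {hd xs, xs ! 1} \<le> rel_entropy (incident E (hd xs)) p' (prob x)"
      using branch_hd_edge[OF xs] by (intro D.binary_div_le_rel_entropy) (simp add: incident_def)
    also have "\<dots> \<le> 2 * OD (hd xs)" by (rule D.rel_entropy_le_order_div)
    finally show "edge_div {hd xs, xs ! 1} \<le> 2 * OD (hd xs)" .
  qed
  ultimately show ?thesis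
    using branch_sum_bound[OF \<rho>] by (simp add: sum_distrib_left[symmetric])
qed

lemma branch_hd_not_near:
  assumes r: "2 \<le> r" "r < k" and xs: "xs \<in> branches E m r"
  shows "hd xs \<notin> near m"
proof
  assume "hd xs \<in> near m"
  then obtain z where z: "z \<in> m" "{hd xs, z} \<in> E" by (auto simp: near_def)
  hence uz: "hd xs \<noteq> z" using card_edge by fastforce
  obtain y where y: "m = {z, y}" "y \<noteq> z"
  proof -
    obtain a b where "a \<in> L" "b \<in> R" "m = {a, b}" "a \<noteq> b" by (rule edgeE[OF m])
    with z(1) show ?thesis using that[of a] that[of b] by (auto simp: insert_commute)
  qed
  have "\<exists>r' ys. r' < 2 \<and> ys \<in> branches E m r' \<and> hd ys = hd xs"
  proof (cases "hd xs = y")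
    case True
    hence "[hd xs, z] \<in> branches E m 0" using y by auto
    thus ?thesis by (intro exI[of _ 0] exI[of _ "[hd xs, z]"]) auto
  next
    case False
    have "[z, y] \<in> branches E m 0" using y by auto
    hence "[hd xs, z, y] \<in> branches E m 1" using z uz False by auto
    thus ?thesis by (intro exI[of _ 1] exI[of _ "[hd xs, z, y]"]) auto
  qed
  then obtain r' ys where ys: "r' < 2" "ys \<in> branches E m r'" "hd ys = hd xs" by blast
  have "xs = ys"
    using ys r by (intro branches_hd_inj[OF girth m card_edge[OF m] xs ys(2)]) auto
  moreover have "length xs = r + 2" "length ys = r' + 2"
    using length_branches xs ys(2) by blast+
  ultimately show False using ys r by simp
qed

text \<open>
  Add up the bounds for the levels \<open>2, ..., k - 1\<close>, whose vertices are distinct and not near \<open>m\<close>.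
\<close>

lemma far_bound:
  "(real k - 2) * - ln (prob x m) + (\<Sum>u\<in>near m. OD u)
    \<le> (real k - 2) / 2 * (\<Sum>u\<in>V. BD u) + (\<Sum>u\<in>V. OD u)"
proof -
  have near: "near m \<subseteq> V" by (auto simp: near_def)
  have OD: "0 \<le> OD u" if "u \<in> V" for u
    using dominated.order_div_homogeneous_nonneg dominated_incident[OF pos that]
    by (auto simp: dominated_prob_def)
  have cardk: "real (card {2..<k}) = real k - 2" using k by simp
  have "(real k - 2) * - ln (prob x m) = (\<Sum>\<rho>\<in>{2..<k}. - ln (prob x m))"
    by (simp only: sum_constant cardk)
  also have "\<dots> \<le> (\<Sum>\<rho>\<in>{2..<k}. (\<Sum>u\<in>V. BD u) / 2 + (\<Sum>xs\<in>branches E m \<rho>. OD (hd xs)))"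
    by (intro sum_mono branch_level_bound) auto
  also have "\<dots> = (real k - 2) / 2 * (\<Sum>u\<in>V. BD u)
      + (\<Sum>\<rho>\<in>{2..<k}. \<Sum>xs\<in>branches E m \<rho>. OD (hd xs))"
    by (simp only: sum.distrib sum_constant cardk times_divide_eq_left times_divide_eq_right)
  also have "(\<Sum>\<rho>\<in>{2..<k}. \<Sum>xs\<in>branches E m \<rho>. OD (hd xs)) \<le> (\<Sum>u\<in>V - near m. OD u)"
    using finite_V OD branch_hd_in_V branch_hd_not_near by (intro sum_branches_le) auto
  also have "(\<Sum>u\<in>V - near m. OD u) = (\<Sum>u\<in>V. OD u) - (\<Sum>u\<in>near m. OD u)"
    using near finite_V by (simp add: sum_diff)
  finally show ?thesis by simp
qed

end


section \<open>Divergence near a conditioned edge\<close>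

text \<open>
  Condition on each of the edges \<open>m\<close> at a neighbour \<open>z\<close> of \<open>u\<close> in turn. If \<open>m = e\<close>, the vertex \<open>u\<close> is
  settled; otherwise the coordinate \<open>e\<close> is excluded at \<open>u\<close>. The lower bound for the excluded case is linear,
  so only the total mass matters, and this is the unconditional mass of \<open>B - {e}\<close>.
\<close>

lemma star_bound:
  assumes e: "{u, z} \<in> E"
  defines "I \<equiv> incident E u" and "e \<equiv> {u, z}"
  shows "- xlnx (prob x e) + (\<Sum>B | B \<subseteq> I \<and> e \<in> B. suffix_weight (card I) (card B) *
      (xlnx (sum (prob x) B) - xlnx (sum (prob x) (B - {e}))))
    \<le> (\<Sum>m\<in>incident E z. prob x m * order_div I (prob (condition x m)) (prob x))"
proof -
  let ?w = "\<lambda>B. suffix_weight (card I) (card B)" and ?s = "\<lambda>B. sum (prob x) B"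
  let ?\<B> = "{B. B \<subseteq> I \<and> e \<in> B}"
  let ?OD = "\<lambda>m. prob x m * order_div I (prob (condition x m)) (prob x)"
  have uz: "u \<in> V" "z \<in> V" "u \<noteq> z" and eE: "e \<in> E"
    using e edge_subset_V[OF e] card_edge[OF e] by (auto simp: e_def)
  have eI: "e \<in> I" and eZ: "e \<in> incident E z"
    using eE by (auto simp: I_def e_def incident_def)
  have dom: "dominated_prob I (prob x) (prob (condition x m))" if "0 < prob x m" for m
    unfolding I_def by (rule dominated_incident[OF that uz(1)])
  have own: "prob x e * (- ln (prob x e) + (\<Sum>B\<in>?\<B>. ?w B * ln (?s B))) \<le> ?OD e"
  proof (cases "prob x e = 0")
    case False
    hence pos: "0 < prob x e" using prob_nonneg[of e] by simp
    show ?thesis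
      using dominated_prob.order_div_point[OF dom[OF pos] eI prob_condition_self[OF pos]] by simp
  qed simp
  have other: "(\<Sum>B\<in>?\<B>. ?w B * ((\<Sum>f\<in>B. joint x m f) * (ln (?s B) - ln (?s (B - {e}))))) \<le> ?OD m"
    if m: "m \<in> incident E z - {e}" for m
  proof (cases "prob x m = 0")
    case True
    hence "joint x m f = 0" for f using joint_le(1)[of m f] joint_nonneg[of m f] by simp
    thus ?thesis using True by simp
  next
    case False
    hence pos: "0 < prob x m" using prob_nonneg[of m] by simp
    have "joint x m e = 0"
      using m uz by (intro joint_disjoint[of z]) (auto simp: incident_def e_def)
    hence "prob (condition x m) e = 0" using prob_condition[of m e] pos by simp
    from dominated_prob.order_div_ge_of_excluded[OF dom[OF pos] eI this]
    have "prob x m * (\<Sum>B\<in>?\<B>. ?w B *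
        (sum (prob (condition x m)) B * (ln (?s B) - ln (?s (B - {e}))))) \<le> ?OD m"
      using pos by (intro mult_left_mono) auto
    also have "prob x m * (\<Sum>B\<in>?\<B>. ?w B *
        (sum (prob (condition x m)) B * (ln (?s B) - ln (?s (B - {e})))))
      = (\<Sum>B\<in>?\<B>. ?w B *
        ((\<Sum>f\<in>B. prob x m * prob (condition x m) f) * (ln (?s B) - ln (?s (B - {e})))))"
      by (simp add: sum_distrib_left[symmetric] mult_ac) (simp add: sum_distrib_left mult_ac)
    finally show ?thesis by (simp only: prob_condition)
  qed
  have others_mass: "(\<Sum>m\<in>incident E z - {e}. \<Sum>f\<in>B. joint x m f) = ?s (B - {e})" if B: "B \<in> ?\<B>" for B
  proof -
    have finB: "finite B" using B finite_incident[of u] by (auto simp: I_def intro: finite_subset)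
    have "(\<Sum>m\<in>incident E z - {e}. \<Sum>f\<in>B. joint x m f)
        = (\<Sum>f\<in>B. \<Sum>m\<in>incident E z - {e}. joint x m f)" by (rule sum.swap)
    also have "\<dots> = (\<Sum>f\<in>B. prob x f - joint x e f)"
      using eZ finite_incident by (simp add: sum_diff1 sum_incident_joint[OF uz(2)])
    also have "\<dots> = (\<Sum>f\<in>B. if f = e then 0 else prob x f)"
    proof (intro sum.cong refl)
      fix f assume "f \<in> B"
      hence "u \<in> f" using B by (auto simp: I_def incident_def)
      thus "prob x f - joint x e f = (if f = e then 0 else prob x f)"
        using joint_self[of e] joint_disjoint[OF uz(1), of e f] by (auto simp: e_def)
    qed
    also have "\<dots> = (\<Sum>f\<in>B - {e}. if f = e then 0 else prob x f)"
      using finB by (intro sum.mono_neutral_right) auto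
    also have "\<dots> = ?s (B - {e})" by (intro sum.cong) auto
    finally show ?thesis .
  qed
  have "(\<Sum>B\<in>?\<B>. ?w B * (?s (B - {e}) * (ln (?s B) - ln (?s (B - {e})))))
      = (\<Sum>B\<in>?\<B>. \<Sum>m\<in>incident E z - {e}.
          ?w B * ((\<Sum>f\<in>B. joint x m f) * (ln (?s B) - ln (?s (B - {e})))))"
    by (intro sum.cong refl)
      (simp only: others_mass[symmetric] sum_distrib_right sum_distrib_left)
  also have "\<dots> = (\<Sum>m\<in>incident E z - {e}. \<Sum>B\<in>?\<B>.
          ?w B * ((\<Sum>f\<in>B. joint x m f) * (ln (?s B) - ln (?s (B - {e})))))"
    by (rule sum.swap)
  also have "\<dots> \<le> (\<Sum>m\<in>incident E z - {e}. ?OD m)"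
    by (intro sum_mono other)
  finally have "prob x e * (- ln (prob x e) + (\<Sum>B\<in>?\<B>. ?w B * ln (?s B)))
      + (\<Sum>B\<in>?\<B>. ?w B * (?s (B - {e}) * (ln (?s B) - ln (?s (B - {e})))))
      \<le> (\<Sum>m\<in>incident E z. ?OD m)"
    using own eZ finite_incident by (simp add: sum.remove)
  also have "prob x e * (- ln (prob x e) + (\<Sum>B\<in>?\<B>. ?w B * ln (?s B)))
      + (\<Sum>B\<in>?\<B>. ?w B * (?s (B - {e}) * (ln (?s B) - ln (?s (B - {e})))))
      = - xlnx (prob x e) + (\<Sum>B\<in>?\<B>. ?w B * (prob x e * ln (?s B)
          + ?s (B - {e}) * (ln (?s B) - ln (?s (B - {e})))))"
    by (simp add: xlnx_def distrib_left right_diff_distrib sum.distrib sum_distrib_left mult_ac)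
  also have "\<dots> = - xlnx (prob x e) + (\<Sum>B\<in>?\<B>. ?w B * (xlnx (?s B) - xlnx (?s (B - {e}))))"
  proof (intro arg_cong2[of _ _ _ _ "(+)"] refl sum.cong)
    fix B assume B: "B \<in> ?\<B>"
    hence "finite B" using finite_incident[of u] by (auto simp: I_def intro: finite_subset)
    hence "?s B = prob x e + ?s (B - {e})" using B by (simp add: sum.remove)
    thus "?w B * (prob x e * ln (?s B) + ?s (B - {e}) * (ln (?s B) - ln (?s (B - {e}))))
        = ?w B * (xlnx (?s B) - xlnx (?s (B - {e})))"
      by (simp add: xlnx_def algebra_simps)
  qed
  finally show ?thesis .
qed

text \<open>
  In a bipartite graph, an edge that has \<open>u\<close> near it contains exactly one neighbour of \<open>u\<close>, so these edges are
  partitioned into the stars at the neighbours. Summing \<open>star_bound\<close> over the neighbours, the correction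
  terms telescope by \<open>suffix_mean_removal\<close> to \<open>xlnx 1 - xlnx 0 = 0\<close>.
\<close>

lemma near_bound:
  assumes u: "u \<in> V"
  shows "shannon_entropy (incident E u) (prob x)
    \<le> (\<Sum>m | m \<in> E \<and> u \<in> near m.
        prob x m * order_div (incident E u) (prob (condition x m)) (prob x))"
proof -
  let ?I = "incident E u" and ?N = "{z. {u, z} \<in> E}"
  let ?OD = "\<lambda>m. prob x m * order_div ?I (prob (condition x m)) (prob x)"
  let ?G = "\<lambda>e. - xlnx (prob x e) + (\<Sum>B | B \<subseteq> ?I \<and> e \<in> B. suffix_weight (card ?I) (card B) *
      (xlnx (sum (prob x) B) - xlnx (sum (prob x) (B - {e}))))"
  have N: "?N \<subseteq> V" using edge_subset_V by blast
  hence finN: "finite ?N" using finite_V by (rule finite_subset)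
  have I: "?I = (\<lambda>z. {u, z}) ` ?N"
  proof
    show "?I \<subseteq> (\<lambda>z. {u, z}) ` ?N"
    proof
      fix e assume "e \<in> ?I"
      hence e: "e \<in> E" "u \<in> e" by (auto simp: incident_def)
      then obtain a b where "e = {a, b}" by (meson edgeE)
      with e show "e \<in> (\<lambda>z. {u, z}) ` ?N" by (auto simp: insert_commute)
    qed
  qed (auto simp: incident_def)
  have inj: "inj_on (\<lambda>z. {u, z}) ?N" by (auto simp: inj_on_def doubleton_eq_iff)
  have near_eq: "{m. m \<in> E \<and> u \<in> near m} = (\<Union>z\<in>?N. incident E z)"
    using u by (auto simp: near_def incident_def)
  have disj: "incident E z \<inter> incident E z' = {}" if "z \<in> ?N" "z' \<in> ?N" "z \<noteq> z'" for z z'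
  proof (rule ccontr)
    have side: "u \<in> L \<longleftrightarrow> y \<in> R" "u \<in> R \<longleftrightarrow> y \<in> L" if y: "y \<in> ?N" for y
    proof -
      obtain a b where "a \<in> L" "b \<in> R" "{u, y} = {a, b}" using edgeE[of "{u, y}"] y by blast
      thus "u \<in> L \<longleftrightarrow> y \<in> R" "u \<in> R \<longleftrightarrow> y \<in> L" using LR by (auto simp: doubleton_eq_iff)
    qed
    assume "incident E z \<inter> incident E z' \<noteq> {}"
    then obtain m where m: "m \<in> E" "z \<in> m" "z' \<in> m" by (auto simp: incident_def)
    obtain a b where "a \<in> L" "b \<in> R" "m = {a, b}" by (rule edgeE[OF m(1)])
    with m that have "a \<in> ?N" "b \<in> ?N" by auto
    thus False using side[of a] side[of b] \<open>a \<in> L\<close> \<open>b \<in> R\<close> LR by auto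
  qed
  have "shannon_entropy ?I (prob x) = (\<Sum>e\<in>?I. ?G e)"
  proof -
    have ne: "?I \<noteq> {}" using sum_incident_prob[OF u] by auto
    have "(\<Sum>e\<in>?I. \<Sum>B | B \<subseteq> ?I \<and> e \<in> B. suffix_weight (card ?I) (card B) *
        (xlnx (sum (prob x) B) - xlnx (sum (prob x) (B - {e})))) = 0"
      using suffix_mean_removal[OF finite_incident ne, of "\<lambda>B. xlnx (sum (prob x) B)"]
        sum_incident_prob[OF u] by (simp add: xlnx_def)
    thus ?thesis by (simp only: sum.distrib sum_negf) (simp add: shannon_entropy_def xlnx_def)
  qed
  also have "\<dots> = (\<Sum>z\<in>?N. ?G {u, z})"
    by (subst (2) I) (simp add: sum.reindex[OF inj])
  also have "\<dots> \<le> (\<Sum>z\<in>?N. \<Sum>m\<in>incident E z. ?OD m)"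
    by (intro sum_mono star_bound) auto
  also have "\<dots> = (\<Sum>m | m \<in> E \<and> u \<in> near m. ?OD m)"
    unfolding near_eq using finN finite_incident disj
    by (intro sum.UNION_disjoint[symmetric]) auto
  finally show ?thesis .
qed

section \<open>The entropy bound\<close>

text \<open>
  Multiply \<open>far_bound\<close> by \<open>p\<^sub>m\<close> and sum over \<open>m\<close>; \<open>near_bound\<close> contributes the two copies of
  \<open>\<Sum>\<^sub>m p\<^sub>m ln (1/p\<^sub>m)\<close> that are missing from \<open>k\<close>.
\<close>

lemma potential_drop:
  "(\<Sum>m\<in>E. - xlnx (prob x m))
    \<le> n * potential (prob x) - (\<Sum>m\<in>E. prob x m * potential (prob (condition x m)))"
proof -
  let ?I = "incident E" and ?q = "prob x" and ?q' = "\<lambda>m. prob (condition x m)"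
  let ?BD = "\<lambda>m u. bethe_div (?I u) (?q' m) ?q" and ?OD = "\<lambda>m u. order_div (?I u) (?q' m) ?q"
  let ?H = "\<Sum>m\<in>E. - xlnx (?q m)"
  define X where "X = (\<Sum>m\<in>E. ?q m * (\<Sum>u\<in>V. ?BD m u))"
  define Y where "Y = (\<Sum>m\<in>E. ?q m * (\<Sum>u\<in>V. ?OD m u))"
  define N where "N = (\<Sum>m\<in>E. ?q m * (\<Sum>u\<in>near m. ?OD m u))"
  have kpos: "0 < real k" using k by simp
  have near_V: "near m \<subseteq> V" for m by (auto simp: near_def)
  have "(\<Sum>u\<in>V. shannon_entropy (?I u) ?q) = 2 * ?H"
    unfolding sum_incident_twice[symmetric] by (simp add: shannon_entropy_def xlnx_def sum_negf)
  moreover have "(\<Sum>u\<in>V. shannon_entropy (?I u) ?q)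
      \<le> (\<Sum>u\<in>V. \<Sum>m | m \<in> E \<and> u \<in> near m. ?q m * ?OD m u)"
    by (intro sum_mono near_bound)
  moreover have "\<dots> = (\<Sum>m\<in>E. \<Sum>u | u \<in> V \<and> u \<in> near m. ?q m * ?OD m u)"
    by (rule sum.swap_restrict[OF finite_V finite_E])
  moreover have "\<dots> = N"
    unfolding N_def sum_distrib_left using near_V
    by (intro sum.cong refl) blast
  ultimately have near_total: "2 * ?H \<le> N" by linarith
  have "?q m * ((real k - 2) * - ln (?q m) + (\<Sum>u\<in>near m. ?OD m u))
      \<le> ?q m * ((real k - 2) / 2 * (\<Sum>u\<in>V. ?BD m u) + (\<Sum>u\<in>V. ?OD m u))" if "m \<in> E" for m
    using far_bound[OF that] prob_nonneg[of m]
    by (cases "?q m = 0") (auto intro!: mult_left_mono)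
  hence "(\<Sum>m\<in>E. ?q m * ((real k - 2) * - ln (?q m) + (\<Sum>u\<in>near m. ?OD m u)))
      \<le> (\<Sum>m\<in>E. ?q m * ((real k - 2) / 2 * (\<Sum>u\<in>V. ?BD m u) + (\<Sum>u\<in>V. ?OD m u)))"
    by (intro sum_mono)
  moreover have "(\<Sum>m\<in>E. ?q m * ((real k - 2) * - ln (?q m) + (\<Sum>u\<in>near m. ?OD m u)))
      = (real k - 2) * ?H + N"
    unfolding N_def sum_distrib_left[of "real k - 2"] sum.distrib[symmetric]
    by (intro sum.cong refl) (simp add: xlnx_def algebra_simps)
  moreover have "(\<Sum>m\<in>E. ?q m * ((real k - 2) / 2 * (\<Sum>u\<in>V. ?BD m u) + (\<Sum>u\<in>V. ?OD m u)))
      = (real k - 2) / 2 * X + Y"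
    unfolding X_def Y_def sum_distrib_left[of "(real k - 2) / 2" _ E]
    by (simp only: distrib_left sum.distrib mult.left_commute)
  ultimately have "real k * ?H \<le> (real k - 2) / 2 * X + Y"
    using near_total by (simp add: left_diff_distrib)
  hence main: "?H \<le> (1/2 - 1 / real k) * X + 1 / real k * Y"
    using kpos by (simp add: field_simps)
  have swap: "(\<Sum>m\<in>E. ?q m * (\<Sum>u\<in>V. h m u)) = (\<Sum>u\<in>V. \<Sum>m\<in>E. ?q m * h m u)" for h :: "'a set \<Rightarrow> 'a \<Rightarrow> real"
    unfolding sum_distrib_left by (rule sum.swap)
  define A where "A p = (\<Sum>u\<in>V. bethe_term (?I u) p)" for p
  define B where "B p = (\<Sum>u\<in>V. order_term (?I u) p)" for p
  define c d where "c = 1/2 - 1 / real k" and "d = 1 / real k"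
  have X: "X = n * A ?q - (\<Sum>m\<in>E. ?q m * A (?q' m))"
    unfolding X_def A_def swap
    by (simp only: average_bethe_div sum_subtractf sum_distrib_left cong: sum.cong)
  have Y: "Y = n * B ?q - (\<Sum>m\<in>E. ?q m * B (?q' m))"
    unfolding Y_def B_def swap by (simp only: average_order_div sum_subtractf sum_distrib_left)
  have pot: "potential p = c * A p + d * B p" for p
    unfolding potential_def A_def B_def c_def d_def by (simp only: sum.distrib sum_distrib_left)
  have "(\<Sum>m\<in>E. ?q m * potential (?q' m)) = c * (\<Sum>m\<in>E. ?q m * A (?q' m)) + d * (\<Sum>m\<in>E. ?q m * B (?q' m))"
    by (simp only: pot distrib_left sum.distrib sum_distrib_left mult.left_commute)
  hence "n * potential ?q - (\<Sum>m\<in>E. ?q m * potential (?q' m)) = c * X + d * Y"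
    unfolding X Y by (simp add: pot algebra_simps)
  thus ?thesis using main by (simp add: c_def d_def)
qed


lemma prob_ge: "M \<in> PM \<Longrightarrow> e \<in> M \<Longrightarrow> x M \<le> prob x e"
  unfolding prob_def using finite_PM law_nonneg by (intro member_le_sum) auto

lemma prob_compl: "prob x e = 1 - (\<Sum>M | M \<in> PM \<and> e \<notin> M. x M)"
proof -
  have "sum x PM = (\<Sum>M | M \<in> PM \<and> e \<in> M. x M) + (\<Sum>M | M \<in> PM \<and> e \<notin> M. x M)"
    using finite_PM by (subst sum.union_disjoint[symmetric]) (auto intro!: sum.cong)
  thus ?thesis using law by (simp add: prob_def law_def)
qed

lemma prob_le: "M \<in> PM \<Longrightarrow> e \<notin> M \<Longrightarrow> prob x e \<le> 1 - x M"
  unfolding prob_compl using finite_PM law_nonneg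
  by (intro diff_left_mono member_le_sum) auto

lemma prob_le_1: "prob x e \<le> 1"
  unfolding prob_compl using sum_nonneg[of "{M. M \<in> PM \<and> e \<notin> M}" x] law_nonneg by auto

lemma potential_deterministic:
  assumes det: "\<And>e. e \<in> E \<Longrightarrow> prob x e = 0 \<or> prob x e = 1"
  shows "potential (prob x) = 0"
proof -
  have "bethe_term (incident E u) (prob x) = 0 \<and> order_term (incident E u) (prob x) = 0" if u: "u \<in> V" for u
  proof -
    let ?I = "incident E u"
    have det': "prob x e = 0 \<or> prob x e = 1" if "e \<in> ?I" for e
      using that det by (simp add: incident_def)
    have "xlnx (sum (prob x) B) = 0" if B: "B \<subseteq> ?I" for B
    proof (cases "\<exists>e\<in>B. prob x e = 1")
      case True
      then obtain e where e: "e \<in> B" "prob x e = 1" by blast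
      have "finite B" using B finite_incident by (rule finite_subset)
      hence "1 \<le> sum (prob x) B" using e prob_nonneg member_le_sum[of e B "prob x"] by auto
      moreover have "sum (prob x) B \<le> 1"
        using sum_mono2[OF finite_incident B, of "prob x"] prob_nonneg sum_incident_prob[OF u] by simp
      ultimately show ?thesis by (simp add: xlnx_def)
    next
      case False
      hence "sum (prob x) B = 0" using B det' by (intro sum.neutral) blast
      thus ?thesis by (simp add: xlnx_def)
    qed
    hence "suffix_mean ?I (\<lambda>B. xlnx (sum (prob x) B)) = 0"
      unfolding suffix_mean_def by (intro sum.neutral) auto
    moreover have "shannon_entropy ?I (prob x) = 0" "complementary_entropy ?I (prob x) = 0"
      unfolding shannon_entropy_def complementary_entropy_def neg_equal_0_iff_equal
      using det' by (intro sum.neutral; force)+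
    ultimately show ?thesis by (simp add: bethe_term_def order_term_def)
  qed
  thus ?thesis by (simp add: potential_def)
qed

lemma entropy_deterministic:
  assumes det: "\<And>e. e \<in> E \<Longrightarrow> prob x e = 0 \<or> prob x e = 1"
  shows "shannon_entropy PM x = 0"
proof -
  have sub: "M \<subseteq> M'" if M: "M \<in> PM" "M' \<in> PM" "0 < x M" "0 < x M'" for M M'
  proof
    fix e assume e: "e \<in> M"
    hence "prob x e = 1" using prob_ge[OF M(1) e] M(3) det[of e] PM_subset[OF M(1)] by auto
    thus "e \<in> M'" using prob_le[OF M(2), of e] M(4) by force
  qed
  have "x M = 0 \<or> x M = 1" if M: "M \<in> PM" for M
  proof (cases "x M = 0")
    case False
    hence pos: "0 < x M" using law_nonneg[OF M] by simp
    have "x M' = 0" if "M' \<in> PM - {M}" for M'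
    proof (rule ccontr)
      assume "x M' \<noteq> 0"
      hence "0 < x M'" using law_nonneg[of M'] that by simp
      hence "M = M'" using sub[of M M'] sub[of M' M] that M pos by auto
      thus False using that by simp
    qed
    hence "sum x (PM - {M}) = 0" by (intro sum.neutral) auto
    hence "sum x PM = x M" using finite_PM M by (simp add: sum.remove)
    thus ?thesis using law by (simp add: law_def)
  qed simp
  hence "x M * ln (x M) = 0" if "M \<in> PM" for M using that by force
  thus ?thesis unfolding shannon_entropy_def neg_equal_0_iff_equal by (intro sum.neutral ballI)
qed

end

text \<open>
  Induction on the size of the support. Conditioning on an edge of probability strictly between 0
  and 1 shrinks the support, and conditioning on a certain edge changes nothing. So if the entropy
  exceeded the potential, the excess would strictly decrease on average, against \<open>entropy_chain\<close> and
  \<open>potential_drop\<close>. If no such edge exists, the law is a point mass and both sides vanish.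
\<close>

lemma entropy_le_potential: "law x \<Longrightarrow> shannon_entropy PM x \<le> potential (prob x)"
proof (induction "card {M \<in> PM. 0 < x M}" arbitrary: x rule: less_induct)
  case less
  note law = less.prems
  show ?case
  proof (cases "\<forall>e\<in>E. prob x e = 0 \<or> prob x e = 1")
    case True
    thus ?thesis using potential_deterministic[OF law] entropy_deterministic[OF law] by simp
  next
    case False
    then obtain e where e: "e \<in> E" "prob x e \<noteq> 0" "prob x e \<noteq> 1" by blast
    define gap where "gap y = shannon_entropy PM y - potential (prob y)" for y
    have strict: "gap (condition x m) \<le> 0" if m: "0 < prob x m" "prob x m < 1" for m
    proof -
      have "\<exists>M\<in>PM. m \<notin> M \<and> x M \<noteq> 0"
      proof (rule ccontr)
        assume "\<not> (\<exists>M\<in>PM. m \<notin> M \<and> x M \<noteq> 0)"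
        hence "(\<Sum>M | M \<in> PM \<and> m \<notin> M. x M) = 0" by (intro sum.neutral) auto
        thus False using prob_compl[OF law, of m] m by simp
      qed
      then obtain M where M: "M \<in> PM" "m \<notin> M" "x M \<noteq> 0" by blast
      have "{M \<in> PM. 0 < condition x m M} \<subset> {M \<in> PM. 0 < x M}"
      proof
        show "{M \<in> PM. 0 < condition x m M} \<subseteq> {M \<in> PM. 0 < x M}"
          using m by (auto simp: condition_def zero_less_divide_iff split: if_splits)
        have "M \<in> {M \<in> PM. 0 < x M} - {M \<in> PM. 0 < condition x m M}"
          using M law_nonneg[OF law M(1)] by (auto simp: condition_def)
        thus "{M \<in> PM. 0 < condition x m M} \<noteq> {M \<in> PM. 0 < x M}" by blast
      qed
      hence "card {M \<in> PM. 0 < condition x m M} < card {M \<in> PM. 0 < x M}"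
        using finite_PM by (intro psubset_card_mono) auto
      from less.hyps[OF this law_condition[OF law m(1)]] show ?thesis by (simp add: gap_def)
    qed
    have same: "gap (condition x m) = gap x" if m: "prob x m = 1" for m
    proof -
      have eq: "condition x m M = x M" if M: "M \<in> PM" for M
        using m prob_le[OF law M, of m] law_nonneg[OF law M] by (auto simp: condition_def)
      hence "prob (condition x m) = prob x"
        unfolding prob_def by (intro ext sum.cong) auto
      moreover have "shannon_entropy PM (condition x m) = shannon_entropy PM x"
        unfolding shannon_entropy_def by (simp add: eq)
      ultimately show ?thesis by (simp add: gap_def)
    qed
    have "n * gap x = n * shannon_entropy PM x - n * potential (prob x)"
      by (simp add: gap_def right_diff_distrib)
    also have "\<dots> \<le> (\<Sum>m\<in>E. prob x m * shannon_entropy PM (condition x m))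
        - (\<Sum>m\<in>E. prob x m * potential (prob (condition x m)))"
      using potential_drop[OF law] unfolding entropy_chain[OF law] sum.distrib by linarith
    also have "\<dots> = (\<Sum>m\<in>E. prob x m * gap (condition x m))"
      by (simp add: gap_def right_diff_distrib sum_subtractf)
    finally have avg: "(\<Sum>m\<in>E. prob x m * gap x) \<le> (\<Sum>m\<in>E. prob x m * gap (condition x m))"
      using sum_edges_prob[OF law] by (simp add: sum_distrib_right[symmetric])
    have "gap x \<le> 0"
    proof (rule ccontr)
      assume "\<not> gap x \<le> 0"
      hence pos: "0 < gap x" by simp
      have le: "prob x m * gap (condition x m) \<le> prob x m * gap x" for m
      proof -
        consider "prob x m = 0" | "prob x m = 1" | "0 < prob x m" "prob x m < 1"
          using prob_nonneg[OF law, of m] prob_le_1[OF law, of m] by linarith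
        thus ?thesis
          by cases (use strict[of m] same[of m] pos in \<open>auto intro!: mult_left_mono\<close>)
      qed
      have "0 < prob x e" "prob x e < 1"
        using e prob_nonneg[OF law, of e] prob_le_1[OF law, of e] by linarith+
      hence "prob x e * gap (condition x e) < prob x e * gap x"
        using strict[of e] pos by simp
      hence "(\<Sum>m\<in>E. prob x m * gap (condition x m)) < (\<Sum>m\<in>E. prob x m * gap x)"
        using finite_E e(1) le by (intro sum_strict_mono_ex1) auto
      thus False using avg by simp
    qed
    thus ?thesis by (simp add: gap_def)
  qed
qed

lemma potential_cong:
  assumes "\<And>e. e \<in> E \<Longrightarrow> p e = q e"
  shows "potential p = potential q"
proof -
  have "shannon_entropy (incident E u) p = shannon_entropy (incident E u) q"
    "complementary_entropy (incident E u) p = complementary_entropy (incident E u) q" for u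
    using assms by (simp_all add: shannon_entropy_def complementary_entropy_def incident_def)
  moreover have "suffix_mean (incident E u) (\<lambda>B. xlnx (sum p B))
      = suffix_mean (incident E u) (\<lambda>B. xlnx (sum q B))" for u
  proof -
    have "sum p B = sum q B" if "B \<subseteq> incident E u" for B
      using that assms by (intro sum.cong) (auto simp: incident_def)
    thus ?thesis unfolding suffix_mean_def by (intro sum.cong) auto
  qed
  ultimately show ?thesis by (simp add: potential_def bethe_term_def order_term_def)
qed

end

theorem theorem3p1:
  fixes L R :: "'a set" and E :: "'a set set" and n g :: nat
    and \<mu> :: "'a set set pmf" and p :: "'a set \<Rightarrow> real"
  assumes "4 \<le> g" and "even g"
    and "bipartite_graph L R E" and "enat g \<le> girth E"
    and "card L = n" and "card R = n"
    and "set_pmf \<mu> \<subseteq> perfect_matchings (L \<union> R) E"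
    and "\<forall>e\<in>E. p e = measure_pmf.prob \<mu> {M. e \<in> M}"
  shows "shannon_entropy (perfect_matchings (L \<union> R) E) (pmf \<mu>) \<le> Phi g (L \<union> R) E p
    \<and> shannon_entropy (perfect_matchings (L \<union> R) E) (pmf \<mu>) - bethe_entropy E p
        \<le> 2 / real g * (\<Sum>v\<in>L \<union> R. F (incident E v) p)"
proof -
  obtain k where g: "g = 2 * k" using \<open>even g\<close> by blast
  interpret bipartite_girth L R E k
    using assms g by unfold_locales auto
  have "law (pmf \<mu>)"
    using finite_PM assms(7) by (simp add: law_def sum_pmf_eq_1)
  hence "shannon_entropy PM (pmf \<mu>) \<le> potential (prob (pmf \<mu>))"
    by (rule entropy_le_potential)
  also have "potential (prob (pmf \<mu>)) = potential p"
  proof (rule potential_cong)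
    fix e assume "e \<in> E"
    have "measure_pmf.prob \<mu> {M. e \<in> M} = measure_pmf.prob \<mu> {M \<in> PM. e \<in> M}"
      by (rule measure_pmf.finite_measure_eq_AE) (use assms(7) in \<open>auto simp: AE_measure_pmf_iff\<close>)
    also have "\<dots> = prob (pmf \<mu>) e"
      using finite_PM by (simp add: measure_measure_pmf_finite prob_def)
    finally show "prob (pmf \<mu>) e = p e" using assms(8) \<open>e \<in> E\<close> by simp
  qed
  also have "\<dots> = Phi g (L \<union> R) E p"
    by (simp only: Phi_eq_potential g)
  finally show ?thesis by (simp add: Phi_def)
qed

end
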